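(* Let $a,b,c,d,u,v,\alpha,\beta$ be complex numbers with $a,u,v\ne 0$ and $\max\{|au|,|av|,|cu|,|cv|,|du|,|dv|,|\alpha q|,|\beta q|\}<1$. Then $$\int_u^v\frac{(qx/u,qx/v;q)_\infty}{(cx,dx;q)_\infty}\;{}_0\phi_1\left(\begin{gathered}-\\ \alpha q\end{gathered};\,q,\,-\alpha qax\right)\;{}_2\phi_1\left(\begin{gathered}b/a,\,0\\ \beta q\end{gathered};\,q,\,-ax\right)d_qx$$ $$=\frac{(1-q)v\,(q,u/v,qv/u,dcuv;q)_\infty}{(du,dv,cu,cv;q)_\infty}\sum_{n=0}^\infty\frac{q^{n(n-1)/2}\,W_n(d,c,u,v)}{(\beta q;q)_n(q;q)_n}\,p_n^{(\alpha,\beta)}(a,b).$$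
   Context: Fix $q$ with $0<|q|<1$. $(a;q)_0=1$, $(a;q)_n=\prod_{i=0}^{n-1}(1-aq^i)$, $(a;q)_\infty=\prod_{i\ge0}(1-aq^i)$, $(a_1,\dots,a_r;q)_n=(a_1;q)_n\cdots(a_r;q)_n$ (also for $n=\infty$), $\begin{bmatrix} n\\ k\end{bmatrix}=\frac{(q;q)_n}{(q;q)_k(q;q)_{n-k}}$. The Jackson $q$-integral is $\int_a^b f(x)\,d_qx=(1-q)\sum_{n=0}^\infty[bf(bq^n)-af(aq^n)]q^n$. ${}_0\phi_1\left(\begin{gathered}-\\ b\end{gathered};q,z\right)=\sum_{n=0}^\infty\frac{q^{n(n-1)}z^n}{(b;q)_n(q;q)_n}$ and ${}_2\phi_1\left(\begin{gathered}a,0\\ b\end{gathered};q,z\right)=\sum_{n=0}^\infty\frac{(a;q)_n}{(b;q)_n(q;q)_n}z^n$. Polynomials: $p_n^{(\alpha,\beta)}(x,y)=\sum_{k=0}^n q^{k(k+1-2n)/2}\begin{bmatrix} n\\ k\end{bmatrix}\frac{(\alpha\beta q^{n+1};q)_k}{(\alpha q;q)_k}(-x)^ky^{n-k}$ (homogeneous little $q$-Jacobi) and $W_n(a,b,u,v)=\sum_{k=0}^n\begin{bmatrix} n\\ k\end{bmatrix}\frac{(av,bv;q)_k}{(abuv;q)_k}u^kv^{n-k}$. *)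

theory Defs
  imports "HOL-Analysis.Analysis"
begin

text \<open>The base \<open>q\<close> is an explicit argument throughout; it is the last argument of the
  Pochhammer symbols, as in \<open>(a;q)\<^sub>n\<close>.\<close>

definition qpoch :: "complex \<Rightarrow> nat \<Rightarrow> complex \<Rightarrow> complex" where
  "qpoch a n q = (\<Prod>i<n. 1 - a * q ^ i)"

definition qpoch_inf :: "complex \<Rightarrow> complex \<Rightarrow> complex" where
  "qpoch_inf a q = (\<Prod>i. 1 - a * q ^ i)"

text \<open>Multi-parameter symbols \<open>(a\<^sub>1,\<dots>,a\<^sub>r;q)\<^sub>n\<close>
  and \<open>(a\<^sub>1,\<dots>,a\<^sub>r;q)\<^sub>\<infinity>\<close>.\<close>

definition qpochs :: "complex list \<Rightarrow> nat \<Rightarrow> complex \<Rightarrow> complex" where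
  "qpochs as n q = (\<Prod>a\<leftarrow>as. qpoch a n q)"

definition qpochs_inf :: "complex list \<Rightarrow> complex \<Rightarrow> complex" where
  "qpochs_inf as q = (\<Prod>a\<leftarrow>as. qpoch_inf a q)"

text \<open>Only meaningful for \<open>k \<le> n\<close>, because of the truncated subtraction.\<close>

definition qbinom :: "nat \<Rightarrow> nat \<Rightarrow> complex \<Rightarrow> complex" where
  "qbinom n k q = qpoch q n q / (qpoch q k q * qpoch q (n - k) q)"

text \<open>The Jackson integral from \<open>s\<close> to \<open>t\<close>; the end points are arbitrary complex numbers.\<close>

definition jackson_integral ::
    "complex \<Rightarrow> complex \<Rightarrow> complex \<Rightarrow> (complex \<Rightarrow> complex) \<Rightarrow> complex" where
  "jackson_integral q s t f =
     (1 - q) * (\<Sum>n. (t * f (t * q ^ n) - s * f (s * q ^ n)) * q ^ n)"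

definition phi01 :: "complex \<Rightarrow> complex \<Rightarrow> complex \<Rightarrow> complex" where
  "phi01 b q z = (\<Sum>n. q ^ (n * (n - 1)) * z ^ n / (qpoch b n q * qpoch q n q))"

text \<open>The series \<open>\<^sub>2\<phi>\<^sub>1(a,0; b; q, z)\<close>, whose second upper parameter is fixed to be zero.\<close>

definition phi21_zero :: "complex \<Rightarrow> complex \<Rightarrow> complex \<Rightarrow> complex \<Rightarrow> complex" where
  "phi21_zero a b q z = (\<Sum>n. qpoch a n q / (qpoch b n q * qpoch q n q) * z ^ n)"

text \<open>Homogeneous little \<open>q\<close>-Jacobi polynomials. The exponent \<open>k(k+1-2n)/2\<close> is an integer,
  possibly negative, so the integer division is exact and the power is an integer power.\<close>

definition little_q_jacobi ::
    "complex \<Rightarrow> complex \<Rightarrow> complex \<Rightarrow> nat \<Rightarrow> complex \<Rightarrow> complex \<Rightarrow> complex" where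
  "little_q_jacobi q \<alpha> \<beta> n x y =
     (\<Sum>k\<le>n. q powi (int k * (int k + 1 - 2 * int n) div 2) * qbinom n k q
        * (qpoch (\<alpha> * \<beta> * q ^ (n + 1)) k q / qpoch (\<alpha> * q) k q) * (- x) ^ k * y ^ (n - k))"

definition W_poly ::
    "complex \<Rightarrow> nat \<Rightarrow> complex \<Rightarrow> complex \<Rightarrow> complex \<Rightarrow> complex \<Rightarrow> complex" where
  "W_poly q n a b u v =
     (\<Sum>k\<le>n. qbinom n k q * (qpochs [a * v, b * v] k q / qpoch (a * b * u * v) k q)
        * u ^ k * v ^ (n - k))"

end

theory Submission
  imports Defs
begin

text \<open>
  Write \<open>F\<^sub>n(u,v)\<close> for the integral of \<open>x\<^sup>n\<close> against the weight
  \<open>w = (qx/u,qx/v)\<^sub>\<infinity> / (cx,dx)\<^sub>\<infinity>\<close>. Since \<open>(x/v)\<^sub>\<infinity> = (1 - x/v)(qx/v)\<^sub>\<infinity>\<close> vanishes at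
  \<open>x = v\<close>, replacing \<open>v\<close> by \<open>qv\<close> in the weight and in the end point gives
  \<open>F\<^sub>n\<^sub>+\<^sub>1(u,v) = v (F\<^sub>n(u,v) - F\<^sub>n(u,qv))\<close>; by \<open>q\<close>-Pascal this is the recursion of
  \<open>W\<^sub>n\<close> times the value of \<open>F\<^sub>0\<close>.

  For \<open>F\<^sub>0\<close>, telescoping \<open>(x/u,x/v)\<^sub>\<infinity> / (cx,dx)\<^sub>\<infinity>\<close> expresses \<open>F\<^sub>1\<close> through \<open>F\<^sub>0\<close>, which yields
  \<open>(1 - cu)(1 - cv) F\<^sub>0(c,d) = (1 - cduv) F\<^sub>0(cq,d)\<close> and in the limit reduces \<open>F\<^sub>0\<close> to
  \<open>c = d = 0\<close>. There the same reduction, read backwards from \<open>c = q/u\<close>, \<open>d = q/v\<close> (where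
  \<open>w = 1\<close>), gives the value if \<open>|q| < |u/v| < 1/|q|\<close>, and quasi-periodicity under
  \<open>v \<mapsto> qv\<close> gives it everywhere.

  Finally, the product of the two hypergeometric series is the generating function of the
  little \<open>q\<close>-Jacobi polynomials, by the finite \<open>q\<close>-binomial theorem and \<open>q\<close>-Vandermonde; it is
  integrated term by term.
\<close>

section \<open>Finite q-shifted factorials and arithmetic of exponents\<close>

lemma qpochs_pair: "qpochs [a, b] n q = qpoch a n q * qpoch b n q"
  by (simp add: qpochs_def)

lemma qpochs_inf_pair: "qpochs_inf [a, b] q = qpoch_inf a q * qpoch_inf b q"
  by (simp add: qpochs_inf_def)

lemma qpoch_0 [simp]: "qpoch a 0 q = 1"
  by (simp add: qpoch_def)

lemma qpoch_inf_zero [simp]: "qpoch_inf 0 q = 1"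
  by (simp add: qpoch_inf_def)

lemma qpoch_Suc: "qpoch a (Suc n) q = qpoch a n q * (1 - a * q ^ n)"
  by (simp add: qpoch_def)

lemma qpoch_add: "qpoch a (m + n) q = qpoch a m q * qpoch (a * q ^ m) n q"
  by (induction n) (simp_all add: qpoch_Suc power_add mult.assoc)

lemma triangle_Suc: "Suc k * (Suc k - 1) div 2 = k * (k - 1) div 2 + k"
  by (cases k) (simp_all add: algebra_simps)

lemma double_triangle: "k * (k - 1) = 2 * (k * (k - 1) div 2)" for k :: nat
  by (cases k) simp_all

lemma int_double_triangle: "2 * int (k * (k - 1) div 2) = int k * (int k - 1)"
proof -
  have "2 * int (k * (k - 1) div 2) = int (2 * (k * (k - 1) div 2))"
    by (simp only: of_nat_mult of_nat_numeral)
  also have "2 * (k * (k - 1) div 2) = k * (k - 1)"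
    by (rule double_triangle[symmetric])
  finally have "2 * int (k * (k - 1) div 2) = int (k * (k - 1))" .
  then show ?thesis by (cases k) (simp_all add: algebra_simps)
qed

text \<open>Merges the prefactor \<open>q ^ (n * (n - 1) div 2)\<close> of the final series with the
  possibly negative exponent in \<open>little_q_jacobi\<close>. The outcome is the natural exponent
  that the finite q-binomial theorem attaches to \<open>b ^ (n - m)\<close>.\<close>

lemma triangle_exponent:
  assumes "m \<le> n"
  shows "int (n * (n - 1) div 2) + int m * (int m + 1 - 2 * int n) div 2
     = int ((n - m) * (n - m - 1) div 2)"
proof -
  obtain j where n: "n = m + j" using le_Suc_ex[OF assms] by blast
  have "even (int m * (int m + 1 - 2 * int n))" by simp
  then have "2 * (int m * (int m + 1 - 2 * int n) div 2) = int m * (int m + 1 - 2 * int n)"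
    by simp
  moreover have "2 * int (n * (n - 1) div 2) = int n * (int n - 1)"
    by (rule int_double_triangle)
  moreover have "2 * int ((n - m) * (n - m - 1) div 2) = int j * (int j - 1)"
    unfolding int_double_triangle by (simp add: n)
  moreover have "int n * (int n - 1) + int m * (int m + 1 - 2 * int n) = int j * (int j - 1)"
    by (simp add: n algebra_simps)
  ultimately show ?thesis by linarith
qed

text \<open>When \<open>j\<close> is the exponent of \<open>b\<close> in a form of degree
  \<open>n\<close>, the new outer index \<open>m = n - j\<close> is the exponent of
  \<open>- a\<close>, so the regrouping collects the coefficient of each monomial.\<close>

lemma sum_triangle_antidiagonal:
  fixes g :: "nat \<Rightarrow> nat \<Rightarrow> 'a :: comm_monoid_add"
  shows "(\<Sum>k\<le>n. \<Sum>j\<le>n - k. g k j) = (\<Sum>m\<le>n. \<Sum>k\<le>m. g k (n - m))"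
proof -
  have "(\<Sum>k\<le>n. \<Sum>j\<le>n - k. g k j) = (\<Sum>(k, j)\<in>(SIGMA k:{..n}. {..n - k}). g k j)"
    by (rule sum.Sigma) auto
  also have "\<dots> = (\<Sum>(m, k)\<in>(SIGMA m:{..n}. {..m}). g k (n - m))"
    by (rule sum.reindex_bij_witness[where i = "\<lambda>(m, k). (k, n - m)" and j = "\<lambda>(k, j). (n - j, k)"])
       auto
  also have "\<dots> = (\<Sum>m\<le>n. \<Sum>k\<le>m. g k (n - m))"
    by (rule sum.Sigma[symmetric]) auto
  finally show ?thesis .
qed

text \<open>Summability is asked of the scaled series, which admits \<open>c = 0\<close> with a
  divergent \<open>f\<close>; both sides are then 0.\<close>

lemma suminf_cmult_unconditional:
  fixes f :: "nat \<Rightarrow> 'a :: real_normed_field"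
  assumes "summable (\<lambda>n. c * f n)"
  shows "(\<Sum>n. c * f n) = c * (\<Sum>n. f n)"
  using assms by (cases "c = 0") (simp_all add: suminf_mult)

section \<open>Infinite q-shifted factorials for a base inside the unit disc\<close>

locale q_base =
  fixes q :: complex
  assumes q_nz: "q \<noteq> 0" and norm_q: "norm q < 1"
begin

lemma mult_power_q_neq_1:
  assumes "norm a < 1"
  shows "a * q ^ i \<noteq> 1"
proof -
  have "norm (a * q ^ i) \<le> norm a * 1"
    unfolding norm_mult norm_power
    using norm_q by (intro mult_left_mono power_le_one) auto
  then show ?thesis using assms by auto
qed

lemma qpoch_nz: "norm a < 1 \<Longrightarrow> qpoch a n q \<noteq> 0"
  using mult_power_q_neq_1[of a] by (auto simp: qpoch_def)

lemma convergent_prod_qpoch: "convergent_prod (\<lambda>i. 1 - a * q ^ i)"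
proof -
  have "summable (\<lambda>i. norm a * norm q ^ i)"
    using norm_q by (intro summable_mult summable_geometric) simp
  then show ?thesis
    by (intro abs_convergent_prod_imp_convergent_prod)
       (simp add: abs_convergent_prod_conv_summable norm_mult norm_power)
qed

lemma qpoch_LIMSEQ: "(\<lambda>n. qpoch a n q) \<longlonglongrightarrow> qpoch_inf a q"
proof -
  have "(\<lambda>n. qpoch a (Suc n) q) \<longlonglongrightarrow> qpoch_inf a q"
    using convergent_prod_LIMSEQ[OF convergent_prod_qpoch[of a]]
    by (simp add: qpoch_def qpoch_inf_def lessThan_Suc_atMost)
  then show ?thesis by (rule LIMSEQ_imp_Suc)
qed

lemma qpoch_inf_nz: "norm a < 1 \<Longrightarrow> qpoch_inf a q \<noteq> 0"
  unfolding qpoch_inf_def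
  using mult_power_q_neq_1[of a] by (intro prodinf_nonzero convergent_prod_qpoch) auto

lemma qpoch_inf_split: "qpoch_inf a q = qpoch a n q * qpoch_inf (a * q ^ n) q"
proof (rule LIMSEQ_unique)
  show "(\<lambda>m. qpoch a (m + n) q) \<longlonglongrightarrow> qpoch_inf a q"
    using qpoch_LIMSEQ by (rule LIMSEQ_ignore_initial_segment)
  show "(\<lambda>m. qpoch a (m + n) q) \<longlonglongrightarrow> qpoch a n q * qpoch_inf (a * q ^ n) q"
    by (simp add: add.commute[of _ n] qpoch_add tendsto_mult_left qpoch_LIMSEQ)
qed

lemma qpoch_inf_rec: "qpoch_inf a q = (1 - a) * qpoch_inf (q * a) q"
  using qpoch_inf_split[of a 1] by (simp add: qpoch_Suc mult.commute)

lemma qpoch_inf_one [simp]: "qpoch_inf 1 q = 0"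
  using qpoch_inf_rec[of 1] by simp

lemma mult_power_q_tendsto_0: "(\<lambda>n. z * q ^ n) \<longlonglongrightarrow> 0"
  using norm_q by (intro tendsto_mult_right_zero LIMSEQ_power_zero) auto

lemma qpoch_inf_tendsto_1: "(\<lambda>n. qpoch_inf (z * q ^ n) q) \<longlonglongrightarrow> 1"
proof -
  have "eventually (\<lambda>n. norm (z * q ^ n) < 1) sequentially"
    using mult_power_q_tendsto_0[of z] tendsto_norm_zero order_tendstoD(2) zero_less_one by blast
  then obtain m where m: "norm (z * q ^ m) < 1"
    by (auto simp: eventually_sequentially)
  define y where "y = z * q ^ m"
  have y: "norm y < 1" using m by (simp add: y_def)
  have eq: "qpoch_inf (y * q ^ n) q = qpoch_inf y q / qpoch y n q" for n
    using qpoch_inf_split[of y n] qpoch_nz[OF y, of n] by (simp add: field_simps)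
  have "(\<lambda>n. qpoch_inf y q / qpoch y n q) \<longlonglongrightarrow> qpoch_inf y q / qpoch_inf y q"
    by (intro tendsto_intros qpoch_LIMSEQ qpoch_inf_nz y)
  then have "(\<lambda>n. qpoch_inf (y * q ^ n) q) \<longlonglongrightarrow> 1"
    using qpoch_inf_nz[OF y] by (simp add: eq)
  then have "(\<lambda>n. qpoch_inf (z * q ^ (n + m)) q) \<longlonglongrightarrow> 1"
    by (simp add: y_def power_add mult_ac)
  then show ?thesis by (rule LIMSEQ_offset)
qed

subsection \<open>Jackson integrals\<close>

definition jackson_term :: "complex \<Rightarrow> complex \<Rightarrow> (complex \<Rightarrow> complex) \<Rightarrow> nat \<Rightarrow> complex" where
  "jackson_term s t f n = (t * f (t * q ^ n) - s * f (s * q ^ n)) * q ^ n"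

lemma jackson_integral_altdef: "jackson_integral q s t f = (1 - q) * suminf (jackson_term s t f)"
  by (simp add: jackson_integral_def jackson_term_def[abs_def])

text \<open>Convergence along both lattices is what makes the Jackson series absolutely convergent,
  and unlike boundedness it is covered by the standard limit rules.\<close>

definition conv_at :: "complex \<Rightarrow> (complex \<Rightarrow> complex) \<Rightarrow> bool" where
  "conv_at t f \<longleftrightarrow> convergent (\<lambda>n. f (t * q ^ n))"

lemma conv_at_bounded:
  assumes "conv_at t f"
  obtains M where "\<And>n. norm (f (t * q ^ n)) \<le> M"
proof -
  from convergent_imp_Bseq[OF assms[unfolded conv_at_def]] show ?thesis
    using that by (auto elim!: BseqE)
qed

lemma conv_at_const [simp, intro]: "conv_at t (\<lambda>x. k)"
  and conv_at_ident [simp, intro]: "conv_at t (\<lambda>x. x)"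
  using mult_power_q_tendsto_0[of t]
  by (auto simp: conv_at_def convergent_const intro: convergentI)

lemma conv_at_add [intro]: "conv_at t f \<Longrightarrow> conv_at t g \<Longrightarrow> conv_at t (\<lambda>x. f x + g x)"
  and conv_at_diff [intro]: "conv_at t f \<Longrightarrow> conv_at t g \<Longrightarrow> conv_at t (\<lambda>x. f x - g x)"
  and conv_at_mult [intro]: "conv_at t f \<Longrightarrow> conv_at t g \<Longrightarrow> conv_at t (\<lambda>x. f x * g x)"
  by (auto simp: conv_at_def intro: convergent_add convergent_diff convergent_mult)

lemma conv_at_power [intro]: "conv_at t f \<Longrightarrow> conv_at t (\<lambda>x. f x ^ n)"
  by (induction n) auto

lemma norm_jackson_term_le:
  assumes "\<And>n. norm (f (s * q ^ n)) \<le> M" and "\<And>n. norm (f (t * q ^ n)) \<le> M"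
  shows "norm (jackson_term s t f n) \<le> ((norm s + norm t) * M) * norm q ^ n"
proof -
  have "norm (t * f (t * q ^ n) - s * f (s * q ^ n)) \<le> norm t * M + norm s * M"
    using assms by (intro norm_triangle_le_diff add_mono) (auto simp: norm_mult mult_left_mono)
  then show ?thesis
    unfolding jackson_term_def norm_mult norm_power
    by (intro mult_right_mono) (auto simp: algebra_simps)
qed

lemma summable_jackson_term:
  assumes "conv_at s f" and "conv_at t f"
  shows "summable (jackson_term s t f)"
proof -
  obtain M1 where M1: "\<And>n. norm (f (s * q ^ n)) \<le> M1" using conv_at_bounded[OF assms(1)] by blast
  obtain M2 where M2: "\<And>n. norm (f (t * q ^ n)) \<le> M2" using conv_at_bounded[OF assms(2)] by blast
  have "summable (\<lambda>n. ((norm s + norm t) * max M1 M2) * norm q ^ n)"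
    using norm_q by (intro summable_mult summable_geometric) simp
  then show ?thesis
    by (rule summable_comparison_test')
       (rule norm_jackson_term_le; meson M1 M2 max.coboundedI1 max.coboundedI2)
qed

lemma jackson_integral_cong:
  assumes "\<And>n. f (s * q ^ n) = g (s * q ^ n)" and "\<And>n. f (t * q ^ n) = g (t * q ^ n)"
  shows "jackson_integral q s t f = jackson_integral q s t g"
  by (simp add: jackson_integral_def assms)

lemma jackson_integral_cmult:
  assumes "conv_at s f" and "conv_at t f"
  shows "jackson_integral q s t (\<lambda>x. k * f x) = k * jackson_integral q s t f"
proof -
  have "jackson_term s t (\<lambda>x. k * f x) = (\<lambda>n. k * jackson_term s t f n)"
    by (auto simp: jackson_term_def algebra_simps)
  then show ?thesis
    using suminf_mult[OF summable_jackson_term[OF assms], of k]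
    by (simp add: jackson_integral_altdef)
qed

lemma jackson_integral_add:
  assumes "conv_at s f" and "conv_at t f" and "conv_at s g" and "conv_at t g"
  shows "jackson_integral q s t (\<lambda>x. f x + g x) = jackson_integral q s t f + jackson_integral q s t g"
proof -
  have "jackson_term s t (\<lambda>x. f x + g x) = (\<lambda>n. jackson_term s t f n + jackson_term s t g n)"
    by (auto simp: jackson_term_def algebra_simps)
  then show ?thesis
    using suminf_add[OF summable_jackson_term summable_jackson_term, OF assms(1,2) assms(3,4), symmetric]
    by (simp add: jackson_integral_altdef ring_distribs)
qed

lemma jackson_integral_diff:
  assumes "conv_at s f" and "conv_at t f" and "conv_at s g" and "conv_at t g"
  shows "jackson_integral q s t (\<lambda>x. f x - g x) = jackson_integral q s t f - jackson_integral q s t g"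
proof -
  have "jackson_term s t (\<lambda>x. f x - g x) = (\<lambda>n. jackson_term s t f n - jackson_term s t g n)"
    by (auto simp: jackson_term_def algebra_simps)
  then show ?thesis
    using suminf_diff[OF summable_jackson_term summable_jackson_term, OF assms(1,2) assms(3,4), symmetric]
    by (simp add: jackson_integral_altdef ring_distribs)
qed

lemma conv_at_sum [intro]: "(\<And>i. i \<in> A \<Longrightarrow> conv_at t (f i)) \<Longrightarrow> conv_at t (\<lambda>x. \<Sum>i\<in>A. f i x)"
  by (induction A rule: infinite_finite_induct) auto

lemma jackson_integral_sum:
  assumes "\<And>i. i \<in> A \<Longrightarrow> conv_at s (f i)" and "\<And>i. i \<in> A \<Longrightarrow> conv_at t (f i)"
  shows "jackson_integral q s t (\<lambda>x. \<Sum>i\<in>A. f i x) = (\<Sum>i\<in>A. jackson_integral q s t (f i))"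
  using assms
proof (induction A rule: infinite_finite_induct)
  case (insert i A)
  then show ?case
    using jackson_integral_add[of s "f i" t "\<lambda>x. \<Sum>i\<in>A. f i x"] by (simp add: conv_at_sum)
qed (simp_all add: jackson_integral_def)

lemma jackson_integral_swap: "jackson_integral q s t f = - jackson_integral q t s f"
  if "conv_at s f" "conv_at t f"
proof -
  have "jackson_term s t f = (\<lambda>n. - jackson_term t s f n)"
    by (auto simp: jackson_term_def algebra_simps)
  then show ?thesis
    using suminf_minus[OF summable_jackson_term[OF that(2,1)]]
    by (simp add: jackson_integral_altdef)
qed

text \<open>Dividing by \<open>x\<close> cancels the lattice weight \<open>t * q ^ n\<close>, so
  each end point contributes a telescoping series. The common limit \<open>l\<close> along the two
  lattices cancels in the difference.\<close>

lemma jackson_integral_telescope: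
  assumes "s \<noteq> 0" and "t \<noteq> 0"
    and "(\<lambda>n. h (s * q ^ n)) \<longlonglongrightarrow> l" and "(\<lambda>n. h (t * q ^ n)) \<longlonglongrightarrow> l"
  shows "jackson_integral q s t (\<lambda>x. (h x - h (q * x)) / x) = (1 - q) * (h t - h s)"
proof -
  define e where "e = (\<lambda>n. h (t * q ^ n) - h (s * q ^ n))"
  have "e \<longlonglongrightarrow> l - l"
    unfolding e_def by (intro tendsto_diff assms)
  then have "(\<lambda>n. e n - e (Suc n)) sums (e 0 - (l - l))"
    by (rule telescope_sums')
  moreover have "jackson_term s t (\<lambda>x. (h x - h (q * x)) / x) = (\<lambda>n. e n - e (Suc n))"
    using assms(1,2) q_nz by (auto simp: jackson_term_def e_def field_simps)
  ultimately show ?thesis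
    by (simp add: jackson_integral_altdef e_def sums_iff)
qed

text \<open>The upper lattice only loses its first point \<open>t\<close>, where \<open>f\<close>
  vanishes.\<close>

lemma jackson_integral_shift_upper:
  assumes "conv_at s f" and "conv_at t f" and "f t = 0"
  shows "jackson_integral q s (t * q) f = jackson_integral q s t f"
proof -
  \<comment> \<open>An end point 0 contributes nothing to a term, so splitting the integral at 0
    separates the two lattices and only the upper one is reindexed.\<close>
  have 0: "conv_at 0 f" by (auto simp: conv_at_def convergent_const)
  define A where "A = jackson_term 0 t f"
  define B where "B = jackson_term s 0 f"
  have sA: "summable A" and sB: "summable B"
    unfolding A_def B_def using assms 0 by (auto intro: summable_jackson_term)
  have "jackson_term s t f = (\<lambda>n. A n + B n)" "jackson_term s (t * q) f = (\<lambda>n. A (Suc n) + B n)"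
    by (auto simp: A_def B_def jackson_term_def algebra_simps)
  moreover have "A 0 = 0" by (simp add: A_def jackson_term_def assms)
  ultimately show ?thesis
    using suminf_split_head[OF sA] sA sB
    by (simp add: jackson_integral_altdef suminf_add[symmetric] summable_Suc_iff)
qed

text \<open>Dominated convergence for Jackson series: a uniform bound on the two lattices gives a
  geometric majorant. It serves both the limit \<open>c * q ^ k\<close> to 0 and the termwise
  integration of the generating function.\<close>

lemma jackson_integral_tendsto:
  assumes "\<And>n. (\<lambda>k. f k (s * q ^ n)) \<longlonglongrightarrow> g (s * q ^ n)"
    and "\<And>n. (\<lambda>k. f k (t * q ^ n)) \<longlonglongrightarrow> g (t * q ^ n)"
    and "\<And>k n. norm (f k (s * q ^ n)) \<le> M" and "\<And>k n. norm (f k (t * q ^ n)) \<le> M"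
  shows "(\<lambda>k. jackson_integral q s t (f k)) \<longlonglongrightarrow> jackson_integral q s t g"
proof -
  have "(\<lambda>k. \<Sum>n. jackson_term s t (f k) n) \<longlonglongrightarrow> (\<Sum>n. jackson_term s t g n)"
  proof (rule tannerys_theorem[THEN conjunct2, THEN conjunct2])
    show "(\<lambda>k. jackson_term s t (f k) n) \<longlonglongrightarrow> jackson_term s t g n" for n
      unfolding jackson_term_def by (intro tendsto_intros assms)
    show "eventually (\<lambda>(n, k). norm (jackson_term s t (f k) n)
            \<le> ((norm s + norm t) * M) * norm q ^ n) (at_top \<times>\<^sub>F sequentially)"
      by (intro always_eventually) (auto intro!: norm_jackson_term_le assms)
    show "summable (\<lambda>n. ((norm s + norm t) * M) * norm q ^ n)"
      using norm_q by (intro summable_mult summable_geometric) simp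
  qed simp
  then show ?thesis
    unfolding jackson_integral_altdef by (intro tendsto_intros)
qed

subsection \<open>Moments of the weight\<close>

lemma qpoch_q_nz [simp]: "qpoch q n q \<noteq> 0"
  using norm_q by (rule qpoch_nz)

lemma qbinom_0 [simp]: "qbinom n 0 q = 1" and qbinom_self [simp]: "qbinom n n q = 1"
  by (simp_all add: qbinom_def)

text \<open>Of the two q-Pascal rules this is the one with \<open>q ^ (n - k)\<close> on the lower
  term, which is the factor that \<open>v ^ (n - k)\<close> acquires when \<open>v\<close> becomes
  \<open>v * q\<close>.\<close>

lemma qbinom_Suc_Suc:
  assumes "k < n"
  shows "qbinom (Suc n) (Suc k) q = qbinom n (Suc k) q + q ^ (n - k) * qbinom n k q"
proof -
  obtain m where n: "n = Suc (k + m)" using less_imp_Suc_add[OF assms] by blast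
  have nz: "1 - q * q ^ i \<noteq> 0" for i
    using mult_power_q_neq_1[OF norm_q, of i] by simp
  have "q ^ n = q * q ^ k * q ^ m" by (simp add: n power_add)
  then show ?thesis
    using nz[of k] nz[of m] qpoch_q_nz[of k] qpoch_q_nz[of m]
    by (simp add: qbinom_def n qpoch_Suc divide_simps) (simp add: algebra_simps power_add)
qed

text \<open>The common induction step for the moments, the q-binomial theorem and q-Vandermonde. The
  end terms are split off because \<open>qbinom n (Suc n) q\<close> is not 0 under truncated
  subtraction.\<close>

lemma qbinom_sum_Suc:
  "(\<Sum>k\<le>Suc n. qbinom (Suc n) k q * f k)
     = (\<Sum>k\<le>n. qbinom n k q * f k) + (\<Sum>k\<le>n. qbinom n k q * (q ^ (n - k) * f (Suc k)))"
proof -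
  note split = sum.atMost_shift[where n = n]
  have "(\<Sum>k\<le>Suc n. qbinom (Suc n) k q * f k)
      = f 0 + (\<Sum>k<n. qbinom (Suc n) (Suc k) q * f (Suc k)) + f (Suc n)"
    by (simp add: sum.atMost_Suc split[of "\<lambda>k. qbinom (Suc n) k q * f k"])
  also have "(\<Sum>k<n. qbinom (Suc n) (Suc k) q * f (Suc k))
      = (\<Sum>k<n. qbinom n (Suc k) q * f (Suc k)) + (\<Sum>k<n. qbinom n k q * (q ^ (n - k) * f (Suc k)))"
    unfolding sum.distrib[symmetric]
    by (intro sum.cong refl) (simp add: qbinom_Suc_Suc algebra_simps)
  also have "(\<Sum>k<n. qbinom n (Suc k) q * f (Suc k)) = (\<Sum>k\<le>n. qbinom n k q * f k) - f 0"
    by (simp add: split[of "\<lambda>k. qbinom n k q * f k"])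
  also have "(\<Sum>k<n. qbinom n k q * (q ^ (n - k) * f (Suc k)))
      = (\<Sum>k\<le>n. qbinom n k q * (q ^ (n - k) * f (Suc k))) - f (Suc n)"
    by (simp add: lessThan_Suc_atMost[symmetric])
  finally show ?thesis by simp
qed

section \<open>The weight, its q-shifts and relations between moments\<close>

definition weight :: "complex \<Rightarrow> complex \<Rightarrow> complex \<Rightarrow> complex \<Rightarrow> complex \<Rightarrow> complex" where
  "weight c d u v x = qpoch_inf (q * x / u) q * qpoch_inf (q * x / v) q
     / (qpoch_inf (c * x) q * qpoch_inf (d * x) q)"

definition moment :: "nat \<Rightarrow> complex \<Rightarrow> complex \<Rightarrow> complex \<Rightarrow> complex \<Rightarrow> complex" where
  "moment n c d u v = jackson_integral q u v (\<lambda>x. x ^ n * weight c d u v x)"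

text \<open>Four free coefficients let this serve the weight as well as the function
  \<open>h\<close> telescoped in \<open>moment_1\<close>. Zeros of the denominator do no harm, since
  the denominator tends to 1.\<close>

lemma qpoch_inf_ratio_tendsto_1:
  "(\<lambda>n. qpoch_inf (k1 * (t * q ^ n)) q * qpoch_inf (k2 * (t * q ^ n)) q
     / (qpoch_inf (k3 * (t * q ^ n)) q * qpoch_inf (k4 * (t * q ^ n)) q)) \<longlonglongrightarrow> 1"
proof -
  have *: "(\<lambda>n. qpoch_inf (k * (t * q ^ n)) q) \<longlonglongrightarrow> 1" for k
    using qpoch_inf_tendsto_1[of "k * t"] by (simp add: mult.assoc)
  show ?thesis
    using tendsto_divide[OF tendsto_mult[OF *[of k1] *[of k2]] tendsto_mult[OF *[of k3] *[of k4]]]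
    by simp
qed

lemma weight_conv_at [intro]: "conv_at t (weight c d u v)"
  using qpoch_inf_ratio_tendsto_1[of "q / u" t "q / v" c d]
  by (auto simp: conv_at_def weight_def convergent_def)

lemma moment_integrand_conv_at [intro]: "conv_at t (\<lambda>x. x ^ n * weight c d u v x)"
  by (intro conv_at_mult conv_at_power conv_at_ident weight_conv_at)

lemma weight_commute: "weight c d u v x = weight d c u v x"
  by (simp add: weight_def mult.commute)

lemma moment_commute: "moment n c d u v = moment n d c u v"
  by (simp add: moment_def weight_commute[of c d])

lemma moment_swap: "moment n c d u v = - moment n c d v u"
proof -
  have "weight c d u v = weight c d v u"
    by (auto simp: weight_def mult_ac)
  then show ?thesis
    unfolding moment_def using moment_integrand_conv_at by (simp add: jackson_integral_swap[of u _ v])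
qed

lemma weight_upper_mult_q:
  "v \<noteq> 0 \<Longrightarrow> weight c d u (v * q) x = (1 - x / v) * weight c d u v x"
  using q_nz qpoch_inf_rec[of "x / v"] by (simp add: weight_def)

lemma moment_Suc:
  assumes "v \<noteq> 0"
  shows "moment (Suc n) c d u v = v * (moment n c d u v - moment n c d u (v * q))"
proof -
  let ?f = "\<lambda>x. x ^ n * weight c d u (v * q) x" and ?g = "\<lambda>x. x ^ n * weight c d u v x"
  have "moment n c d u (v * q) = jackson_integral q u v ?f"
    unfolding moment_def
    by (rule jackson_integral_shift_upper[OF moment_integrand_conv_at moment_integrand_conv_at])
       (use assms in \<open>simp add: weight_upper_mult_q\<close>)
  then have "v * (moment n c d u v - moment n c d u (v * q))
      = v * jackson_integral q u v (\<lambda>x. ?g x - ?f x)"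
    unfolding moment_def by (simp add: jackson_integral_diff moment_integrand_conv_at)
  also have "\<dots> = jackson_integral q u v (\<lambda>x. v * (?g x - ?f x))"
    by (intro jackson_integral_cmult[symmetric] conv_at_diff moment_integrand_conv_at)
  \<comment> \<open>The power rises by one because \<open>v * (1 - (1 - x / v)) = x\<close>.\<close>
  also have "(\<lambda>x. v * (?g x - ?f x)) = (\<lambda>x. x ^ Suc n * weight c d u v x)"
    unfolding weight_upper_mult_q[OF assms] using assms by (simp add: field_simps)
  also have "jackson_integral q u v \<dots> = moment (Suc n) c d u v"
    unfolding moment_def ..
  finally show ?thesis by simp
qed

lemma lattice_neq_1: "norm (c * t) < 1 \<Longrightarrow> c * (t * q ^ n) \<noteq> 1"
  using mult_power_q_neq_1[of "c * t" n] by (simp add: mult.assoc)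

text \<open>At \<open>c * x = 1\<close> the right-hand side is 0 while the left-hand side need not
  be; the norm conditions on \<open>c * u\<close> and \<open>c * v\<close> keep the lattices away
  from that point.\<close>

lemma weight_mult_q: "c * x \<noteq> 1 \<Longrightarrow> weight (c * q) d u v x = (1 - c * x) * weight c d u v x"
  using qpoch_inf_rec[of "c * x"] by (simp add: weight_def mult_ac)

lemma moment_Suc_mult:
  assumes "norm (c * u) < 1" and "norm (c * v) < 1"
  shows "c * moment (Suc n) c d u v = moment n c d u v - moment n (c * q) d u v"
proof -
  have "c * moment (Suc n) c d u v = jackson_integral q u v (\<lambda>x. c * (x ^ Suc n * weight c d u v x))"
    unfolding moment_def by (intro jackson_integral_cmult[symmetric] moment_integrand_conv_at)
  also have "\<dots> = jackson_integral q u v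
      (\<lambda>x. x ^ n * weight c d u v x - x ^ n * weight (c * q) d u v x)"
    using assms
    by (intro jackson_integral_cong) (simp_all add: weight_mult_q lattice_neq_1 algebra_simps)
  also have "\<dots> = moment n c d u v - moment n (c * q) d u v"
    unfolding moment_def by (intro jackson_integral_diff moment_integrand_conv_at)
  finally show ?thesis .
qed

lemma moment_1:
  assumes "u \<noteq> 0" and "v \<noteq> 0"
    and "norm (c * u) < 1" and "norm (c * v) < 1" and "norm (d * u) < 1" and "norm (d * v) < 1"
  shows "(1 - c * d * u * v) * moment 1 c d u v = (u + v - (c + d) * u * v) * moment 0 c d u v"
proof -
  define h where "h x = qpoch_inf (1 / u * x) q * qpoch_inf (1 / v * x) q
     / (qpoch_inf (c * x) q * qpoch_inf (d * x) q)" for x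
  let ?A = "1 / (u * v) - c * d" and ?B = "1 / u + 1 / v - c - d"
  let ?g = "\<lambda>n x. x ^ n * weight c d u v x"
  have h_diff: "(h x - h (q * x)) / x = ?A * ?g 1 x - ?B * ?g 0 x"
    if "x \<noteq> 0" "c * x \<noteq> 1" "d * x \<noteq> 1" for x
  proof -
    have hx: "h x = (1 - x / u) * (1 - x / v) * weight c d u v x"
      using qpoch_inf_rec[of "x / u"] qpoch_inf_rec[of "x / v"] by (simp add: h_def weight_def)
    have hqx: "h (q * x) = (1 - c * x) * (1 - d * x) * weight c d u v x"
      using that qpoch_inf_rec[of "c * x"] qpoch_inf_rec[of "d * x"]
      by (simp add: h_def weight_def mult_ac)
    have "(h x - h (q * x)) / x
        = ((1 - x / u) * (1 - x / v) - (1 - c * x) * (1 - d * x)) / x * weight c d u v x"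
      by (simp only: hx hqx left_diff_distrib[symmetric] times_divide_eq_left)
    \<comment> \<open>The constant terms cancel, so division by \<open>x\<close> leaves a polynomial
      of degree at most one and only the moments 0 and 1 occur.\<close>
    also have "((1 - x / u) * (1 - x / v) - (1 - c * x) * (1 - d * x)) / x = ?A * x - ?B"
      using that assms(1,2) by (simp add: field_simps)
    finally show ?thesis by (simp add: algebra_simps)
  qed
  have "jackson_integral q u v (\<lambda>x. (h x - h (q * x)) / x) = (1 - q) * (h v - h u)"
    unfolding h_def
    by (intro jackson_integral_telescope[of u v _ 1] assms(1,2) qpoch_inf_ratio_tendsto_1)
  \<comment> \<open>Each end point turns one numerator factor of \<open>h\<close> into
    \<open>qpoch_inf 1 q\<close>, which is 0.\<close>
  also have "\<dots> = 0"
    using assms(1,2) by (simp add: h_def)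
  finally have "0 = jackson_integral q u v (\<lambda>x. (h x - h (q * x)) / x)" ..
  also have "\<dots> = jackson_integral q u v (\<lambda>x. ?A * ?g 1 x - ?B * ?g 0 x)"
    using assms q_nz
    by (intro jackson_integral_cong h_diff) (simp_all add: lattice_neq_1)
  also have "\<dots> = jackson_integral q u v (\<lambda>x. ?A * ?g 1 x) - jackson_integral q u v (\<lambda>x. ?B * ?g 0 x)"
    by (intro jackson_integral_diff conv_at_mult[OF conv_at_const] moment_integrand_conv_at)
  also have "\<dots> = ?A * moment 1 c d u v - ?B * moment 0 c d u v"
    unfolding moment_def
    by (simp only: jackson_integral_cmult[OF moment_integrand_conv_at moment_integrand_conv_at])
  finally have "?B * moment 0 c d u v = ?A * moment 1 c d u v" by simp
  then have "u * v * ?B * moment 0 c d u v = u * v * ?A * moment 1 c d u v"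
    by (simp only: mult.assoc)
  moreover have "u * v * ?B = u + v - (c + d) * u * v" "u * v * ?A = 1 - c * d * u * v"
    using assms(1,2) by (simp_all add: field_simps)
  ultimately show ?thesis by simp
qed

text \<open>Eliminates \<open>moment 1\<close> between the two preceding relations; (1 - cu)(1 - cv)
  arises as 1 - cduv - c(u + v - (c + d)uv). Nothing is divided by \<open>c\<close>, so
  \<open>c = 0\<close> is included.\<close>

lemma moment_0_mult_q:
  assumes "u \<noteq> 0" and "v \<noteq> 0"
    and "norm (c * u) < 1" and "norm (c * v) < 1" and "norm (d * u) < 1" and "norm (d * v) < 1"
  shows "(1 - c * u) * (1 - c * v) * moment 0 c d u v
     = (1 - c * d * u * v) * moment 0 (c * q) d u v"
proof -
  have "c * moment 1 c d u v = moment 0 c d u v - moment 0 (c * q) d u v"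
    using moment_Suc_mult[OF assms(3,4), of 0 d] by simp
  then show ?thesis using moment_1[OF assms] by algebra
qed

lemma norm_mult_power_q_less: "norm (c * u) < 1 \<Longrightarrow> norm (c * q ^ n * u) < 1"
proof -
  assume "norm (c * u) < 1"
  moreover have "norm (c * q ^ n * u) = norm (c * u) * norm q ^ n"
    by (simp add: norm_mult norm_power)
  moreover have "norm (c * u) * norm q ^ n \<le> norm (c * u) * 1"
    using norm_q by (intro mult_left_mono power_le_one) auto
  ultimately show ?thesis by linarith
qed

lemma moment_0_mult_power_q:
  assumes "u \<noteq> 0" and "v \<noteq> 0"
    and "norm (c * u) < 1" and "norm (c * v) < 1" and "norm (d * u) < 1" and "norm (d * v) < 1"
  shows "qpoch (c * u) n q * qpoch (c * v) n q * moment 0 c d u v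
     = qpoch (c * d * u * v) n q * moment 0 (c * q ^ n) d u v"
proof (induction n)
  case (Suc n)
  have "(1 - c * q ^ n * u) * (1 - c * q ^ n * v) * moment 0 (c * q ^ n) d u v
      = (1 - c * q ^ n * d * u * v) * moment 0 (c * q ^ n * q) d u v"
    using assms by (intro moment_0_mult_q norm_mult_power_q_less)
  then have step: "(1 - c * u * q ^ n) * (1 - c * v * q ^ n) * moment 0 (c * q ^ n) d u v
      = (1 - c * d * u * v * q ^ n) * moment 0 (c * q ^ Suc n) d u v"
    by (simp add: mult_ac)
  have "qpoch (c * u) (Suc n) q * qpoch (c * v) (Suc n) q * moment 0 c d u v
      = (1 - c * u * q ^ n) * (1 - c * v * q ^ n)
        * (qpoch (c * u) n q * qpoch (c * v) n q * moment 0 c d u v)"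
    by (simp add: qpoch_Suc)
  also have "\<dots> = qpoch (c * d * u * v) n q
        * ((1 - c * u * q ^ n) * (1 - c * v * q ^ n) * moment 0 (c * q ^ n) d u v)"
    unfolding Suc.IH by (simp only: mult_ac)
  also have "\<dots> = qpoch (c * d * u * v) (Suc n) q * moment 0 (c * q ^ Suc n) d u v"
    unfolding step by (simp only: qpoch_Suc mult_ac)
  finally show ?case .
qed simp

text \<open>Isolates the dependence on \<open>k\<close> in a factor that depends on
  \<open>k + n\<close> alone. One convergent sequence thus yields both the limit in \<open>k\<close>
  and a bound uniform in \<open>k\<close> and \<open>n\<close>.\<close>

lemma weight_mult_power_q:
  "weight (c * q ^ k) d u v (t * q ^ n)
     = weight 0 d u v (t * q ^ n) * inverse (qpoch_inf (c * t * q ^ (k + n)) q)"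
  by (simp add: weight_def power_add field_simps)

lemma moment_0_tendsto: "(\<lambda>k. moment 0 (c * q ^ k) d u v) \<longlonglongrightarrow> moment 0 0 d u v"
proof -
  have lim: "(\<lambda>k. weight (c * q ^ k) d u v (t * q ^ n)) \<longlonglongrightarrow> weight 0 d u v (t * q ^ n)" for t n
  proof -
    have "(\<lambda>k. qpoch_inf (c * t * q ^ (k + n)) q) \<longlonglongrightarrow> 1"
      by (rule LIMSEQ_ignore_initial_segment) (rule qpoch_inf_tendsto_1)
    then have "(\<lambda>k. weight 0 d u v (t * q ^ n) * inverse (qpoch_inf (c * t * q ^ (k + n)) q))
        \<longlonglongrightarrow> weight 0 d u v (t * q ^ n) * inverse 1"
      by (intro tendsto_intros) auto
    then show ?thesis by (simp add: weight_mult_power_q)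
  qed
  have bound: "\<exists>M. \<forall>k n. norm (weight (c * q ^ k) d u v (t * q ^ n)) \<le> M" for t
  proof -
    have "convergent (\<lambda>j. inverse (qpoch_inf (c * t * q ^ j) q))"
      using tendsto_inverse[OF qpoch_inf_tendsto_1[of "c * t"]] by (auto simp: convergent_def)
    then obtain M1 where M1: "\<And>j. norm (inverse (qpoch_inf (c * t * q ^ j) q)) \<le> M1"
      using convergent_imp_Bseq by (auto elim!: BseqE)
    obtain M2 where M2: "\<And>n. norm (weight 0 d u v (t * q ^ n)) \<le> M2"
      using conv_at_bounded[OF weight_conv_at] by blast
    have "norm (weight (c * q ^ k) d u v (t * q ^ n)) \<le> M2 * M1" for k n
      unfolding weight_mult_power_q norm_mult
      using M1 M2 order_trans[OF norm_ge_zero M2] by (intro mult_mono) auto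
    then show ?thesis by blast
  qed
  obtain M1 where M1: "\<And>k n. norm (weight (c * q ^ k) d u v (u * q ^ n)) \<le> M1"
    using bound by blast
  obtain M2 where M2: "\<And>k n. norm (weight (c * q ^ k) d u v (v * q ^ n)) \<le> M2"
    using bound by blast
  show ?thesis
    unfolding moment_def power_0 mult_1
    by (rule jackson_integral_tendsto[where M = "max M1 M2"])
       (use lim M1 M2 in \<open>auto intro: max.coboundedI1 max.coboundedI2\<close>)
qed

lemma moment_0_eq_left:
  assumes "u \<noteq> 0" and "v \<noteq> 0"
    and "norm (c * u) < 1" and "norm (c * v) < 1" and "norm (d * u) < 1" and "norm (d * v) < 1"
  shows "qpoch_inf (c * u) q * qpoch_inf (c * v) q * moment 0 c d u v
     = qpoch_inf (c * d * u * v) q * moment 0 0 d u v"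
proof (rule LIMSEQ_unique)
  show "(\<lambda>n. qpoch (c * u) n q * qpoch (c * v) n q * moment 0 c d u v)
      \<longlonglongrightarrow> qpoch_inf (c * u) q * qpoch_inf (c * v) q * moment 0 c d u v"
    by (intro tendsto_intros qpoch_LIMSEQ)
  show "(\<lambda>n. qpoch (c * u) n q * qpoch (c * v) n q * moment 0 c d u v)
      \<longlonglongrightarrow> qpoch_inf (c * d * u * v) q * moment 0 0 d u v"
    unfolding moment_0_mult_power_q[OF assms]
    by (intro tendsto_intros qpoch_LIMSEQ moment_0_tendsto)
qed

text \<open>After \<open>c\<close> has been removed, symmetry of the weight in \<open>c\<close> and
  \<open>d\<close> allows the same reduction for \<open>d\<close>; with the other parameter 0, it
  leaves no product on the right.\<close>

lemma moment_0_eq: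
  assumes "u \<noteq> 0" and "v \<noteq> 0"
    and "norm (c * u) < 1" and "norm (c * v) < 1" and "norm (d * u) < 1" and "norm (d * v) < 1"
  shows "qpoch_inf (c * u) q * qpoch_inf (c * v) q * qpoch_inf (d * u) q * qpoch_inf (d * v) q
       * moment 0 c d u v
     = qpoch_inf (c * d * u * v) q * moment 0 0 0 u v"
proof -
  have M: "moment 0 0 0 u v = qpoch_inf (d * u) q * qpoch_inf (d * v) q * moment 0 0 d u v"
    using moment_0_eq_left[of u v d 0] assms by (simp add: moment_commute[of 0 d 0])
  have "qpoch_inf (c * d * u * v) q * moment 0 0 0 u v = qpoch_inf (d * u) q
      * qpoch_inf (d * v) q * (qpoch_inf (c * d * u * v) q * moment 0 0 d u v)"
    unfolding M by (simp only: mult_ac)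
  then show ?thesis
    unfolding moment_0_eq_left[OF assms, symmetric] by (simp only: mult_ac)
qed

section \<open>Theta quasi-periodicity and the zeroth moment at c = d = 0\<close>

definition theta_factor :: "complex \<Rightarrow> complex \<Rightarrow> complex" where
  "theta_factor u v = (1 - q) * v * (qpoch_inf q q * qpoch_inf (u / v) q * qpoch_inf (q * v / u) q)"

text \<open>The three products form a Jacobi theta function of \<open>u / v\<close>. The shift of
  \<open>v\<close> adds the first factor of one product and removes that of another. The relation is
  stated without division, as the removed factor may be 0.\<close>

lemma theta_factor_mult_q:
  assumes "u \<noteq> 0" and "v \<noteq> 0"
  shows "v * theta_factor u (v * q) = - u * theta_factor u v"
proof -
  have "qpoch_inf (u / (v * q)) q = (1 - u / (v * q)) * qpoch_inf (u / v) q"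
    using qpoch_inf_rec[of "u / (v * q)"] q_nz by simp
  moreover have "qpoch_inf (q * v / u) q = (1 - q * v / u) * qpoch_inf (q * (v * q) / u) q"
    using qpoch_inf_rec[of "q * v / u"] by (simp add: mult_ac)
  ultimately have "v * theta_factor u (v * q) = (1 - q) * v * q * (v * (1 - u / (v * q)))
      * (qpoch_inf q q * qpoch_inf (u / v) q * qpoch_inf (q * (v * q) / u) q)"
    and "u * theta_factor u v = (1 - q) * v * (u * (1 - q * v / u))
      * (qpoch_inf q q * qpoch_inf (u / v) q * qpoch_inf (q * (v * q) / u) q)"
    by (simp_all add: theta_factor_def)
  moreover have "q * (v * (1 - u / (v * q))) = - (u * (1 - q * v / u))"
    using assms q_nz by (simp add: field_simps)
  ultimately show ?thesis by algebra
qed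

lemma theta_factor_swap:
  assumes "u \<noteq> 0" and "v \<noteq> 0"
  shows "theta_factor u v = - theta_factor v u"
proof -
  have "qpoch_inf (u / v) q = (1 - u / v) * qpoch_inf (q * u / v) q"
    and "qpoch_inf (v / u) q = (1 - v / u) * qpoch_inf (q * v / u) q"
    using qpoch_inf_rec[of "u / v"] qpoch_inf_rec[of "v / u"] by simp_all
  moreover have "v * (1 - u / v) = - (u * (1 - v / u))"
    using assms by (simp add: field_simps)
  ultimately show ?thesis unfolding theta_factor_def by algebra
qed

text \<open>Two values of \<open>moment 1 0 0 u v\<close>, one from telescoping and one from
  shifting the end point, give the functional equation of \<open>theta_factor\<close>.\<close>

lemma moment_000_mult_q:
  assumes "u \<noteq> 0" and "v \<noteq> 0"
  shows "v * moment 0 0 0 u (v * q) = - u * moment 0 0 0 u v"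
proof -
  have "moment 1 0 0 u v = (u + v) * moment 0 0 0 u v"
    using moment_1[of u v 0 0] assms by simp
  moreover have "moment 1 0 0 u v = v * (moment 0 0 0 u v - moment 0 0 0 u (v * q))"
    using moment_Suc[of v 0 0 0 u] assms by simp
  ultimately show ?thesis by algebra
qed

text \<open>For \<open>c = q / u\<close> and \<open>d = q / v\<close> the weight is constantly 1 on the lattice.\<close>

lemma moment_000_annulus:
  assumes "u \<noteq> 0" and "v \<noteq> 0" and "norm (q * v / u) < 1" and "norm (q * u / v) < 1"
  shows "moment 0 0 0 u v = theta_factor u v"
proof -
  \<comment> \<open>Numerator and denominator of the weight coincide for these parameters; their
    quotient is 1 only where they do not vanish, which the two annulus conditions guarantee.\<close>
  have nz: "qpoch_inf (q * (t * q ^ n) / s) q \<noteq> 0" if "norm (q * t / s) < 1" for s t n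
  proof -
    have "norm (q / s * q ^ n * t) < 1"
      using norm_mult_power_q_less[of "q / s" t n] that by simp
    then show ?thesis
      using qpoch_inf_nz[of "q / s * q ^ n * t"] by (simp add: mult_ac)
  qed
  have "(\<lambda>n. q ^ n) sums (1 / (1 - q))"
    using norm_q by (rule geometric_sums)
  then have "(\<lambda>n. (v - u) * q ^ n) sums ((v - u) * (1 / (1 - q)))"
    by (rule sums_mult)
  then have "jackson_integral q u v (\<lambda>x. 1) = v - u"
    using norm_q by (auto simp: jackson_integral_def sums_iff)
  moreover have "moment 0 (q / u) (q / v) u v = jackson_integral q u v (\<lambda>x. 1)"
    unfolding moment_def using assms norm_q nz[of u u] nz[of v u] nz[of u v] nz[of v v]
    by (intro jackson_integral_cong) (simp_all add: weight_def)
  moreover have "qpoch_inf (q / u * u) q * qpoch_inf (q / u * v) q * qpoch_inf (q / v * u) q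
        * qpoch_inf (q / v * v) q * moment 0 (q / u) (q / v) u v
      = qpoch_inf (q / u * (q / v) * u * v) q * moment 0 0 0 u v"
    using assms norm_q by (intro moment_0_eq) simp_all
  ultimately have eq: "qpoch_inf q q * qpoch_inf (q * v / u) q * qpoch_inf (q * u / v) q
        * qpoch_inf q q * (v - u) = qpoch_inf (q * q) q * moment 0 0 0 u v"
    using assms(1,2) by simp
  have rec: "qpoch_inf q q = (1 - q) * qpoch_inf (q * q) q"
    by (rule qpoch_inf_rec)
  \<comment> \<open>The integral \<open>v - u\<close> of the constant 1 is absorbed into the product
    with argument \<open>u / v\<close>.\<close>
  have uv: "v * qpoch_inf (u / v) q = (v - u) * qpoch_inf (q * u / v) q"
    using assms(2) qpoch_inf_rec[of "u / v"] by (simp add: field_simps)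
  \<comment> \<open>One of the two copies of \<open>qpoch_inf q q\<close> is expanded, so that the
    nonzero \<open>qpoch_inf (q * q) q\<close> can be cancelled.\<close>
  have "qpoch_inf (q * q) q * moment 0 0 0 u v = qpoch_inf (q * q) q
      * ((1 - q) * qpoch_inf q q * qpoch_inf (q * v / u) q * ((v - u) * qpoch_inf (q * u / v) q))"
    unfolding eq[symmetric] by (subst (2) rec) (simp only: mult_ac)
  moreover have "qpoch_inf (q * q) q \<noteq> 0"
    using qpoch_inf_nz[OF norm_q] rec by auto
  ultimately have "moment 0 0 0 u v
      = (1 - q) * qpoch_inf q q * qpoch_inf (q * v / u) q * ((v - u) * qpoch_inf (q * u / v) q)"
    by simp
  then show ?thesis
    unfolding uv[symmetric] theta_factor_def by (simp only: mult_ac)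
qed

text \<open>Both sides obey the same functional equation, so equality at some
  \<open>v * q ^ n\<close> inside the annulus propagates back to \<open>v\<close>.\<close>

lemma moment_000_le:
  assumes "u \<noteq> 0" and "v \<noteq> 0" and "norm u \<le> norm v"
  shows "moment 0 0 0 u v = theta_factor u v"
proof -
  have step: "moment 0 0 0 u w = theta_factor u w"
    if "w \<noteq> 0" "moment 0 0 0 u (w * q) = theta_factor u (w * q)" for w
    using moment_000_mult_q[of u w] theta_factor_mult_q[of u w] that assms(1) by simp
  have iter: "moment 0 0 0 u (v * q ^ n) = theta_factor u (v * q ^ n)
      \<Longrightarrow> moment 0 0 0 u v = theta_factor u v" for n
  proof (induction n)
    case (Suc n)
    then show ?case
      using step[of "v * q ^ n"] assms(2) q_nz by (simp add: mult_ac)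
  qed simp
  have "eventually (\<lambda>n. norm (v * q ^ n) < norm u) sequentially"
    using assms(1) by (intro order_tendstoD(2)[OF tendsto_norm_zero] mult_power_q_tendsto_0) auto
  then have ex: "\<exists>n. norm (v * q ^ n) \<le> norm u"
    by (auto simp: eventually_sequentially intro: less_imp_le)
  \<comment> \<open>Minimality gives \<open>norm q * norm u < norm (v * q ^ n)\<close>, the other
    annulus bound; for \<open>n = 0\<close> it comes from
    \<open>norm u \<le> norm v\<close>.\<close>
  define n where "n = (LEAST n. norm (v * q ^ n) \<le> norm u)"
  have le: "norm (v * q ^ n) \<le> norm u"
    unfolding n_def by (rule LeastI_ex[OF ex])
  have gt: "norm q * norm u < norm (v * q ^ n)"
  proof (cases n)
    case 0
    have "norm q * norm u < 1 * norm u"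
      using assms(1) norm_q by (intro mult_strict_right_mono) auto
    then show ?thesis using 0 assms(3) by simp
  next
    case (Suc m)
    then have "\<not> norm (v * q ^ m) \<le> norm u"
      using not_less_Least[of m "\<lambda>n. norm (v * q ^ n) \<le> norm u"] by (simp add: n_def)
    then have "norm q * norm u < norm q * norm (v * q ^ m)"
      using q_nz by simp
    then show ?thesis by (simp add: Suc norm_mult mult_ac)
  qed
  have "norm q * norm (v * q ^ n) < norm u"
  proof -
    have "norm q * norm (v * q ^ n) < 1 * norm (v * q ^ n)"
      using assms(2) q_nz norm_q by (intro mult_strict_right_mono) auto
    then show ?thesis using le by simp
  qed
  then have "moment 0 0 0 u (v * q ^ n) = theta_factor u (v * q ^ n)"
    using assms(1,2) q_nz gt
    by (intro moment_000_annulus) (simp_all add: norm_divide norm_mult divide_less_eq)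
  then show ?thesis by (rule iter)
qed

text \<open>Both sides are antisymmetric in \<open>u\<close> and \<open>v\<close>, which settles the
  remaining case.\<close>

lemma moment_000:
  assumes "u \<noteq> 0" and "v \<noteq> 0"
  shows "moment 0 0 0 u v = theta_factor u v"
proof (cases "norm u \<le> norm v")
  case False
  then have "moment 0 0 0 v u = theta_factor v u"
    using assms by (intro moment_000_le) auto
  then show ?thesis
    using moment_swap[of 0 0 0 u v] theta_factor_swap[OF assms] by simp
qed (use assms moment_000_le in blast)

section \<open>The Andrews-Askey integral and the moments of all orders\<close>

definition askey_factor :: "complex \<Rightarrow> complex \<Rightarrow> complex \<Rightarrow> complex \<Rightarrow> complex" where
  "askey_factor c d u v = qpoch_inf (c * d * u * v) q
     / (qpoch_inf (c * u) q * qpoch_inf (c * v) q * qpoch_inf (d * u) q * qpoch_inf (d * v) q)"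

text \<open>The case \<open>n = 0\<close> is the Andrews-Askey integral. Leaving the shifted
  argument \<open>v * q ^ k\<close> unexpanded makes the induction close for all \<open>v\<close>:
  quasi-periodicity turns the subtracted moment at \<open>v * q\<close> into \<open>u\<close> times
  the shifted sum, and q-Pascal joins the two sums.\<close>

lemma moment_eq_sum:
  assumes "u \<noteq> 0" and "v \<noteq> 0"
    and "norm (c * u) < 1" and "norm (c * v) < 1" and "norm (d * u) < 1" and "norm (d * v) < 1"
  shows "moment n c d u v = theta_factor u v
     * (\<Sum>k\<le>n. qbinom n k q * (u ^ k * v ^ (n - k) * askey_factor c d u (v * q ^ k)))"
  using assms
proof (induction n arbitrary: v)
  case 0
  then show ?case
    using moment_0_eq[of u v c d] moment_000[of u v]
    by (simp add: askey_factor_def qpoch_inf_nz divide_simps) (simp add: mult_ac)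
next
  case (Suc n)
  let ?S = "\<lambda>v. \<Sum>k\<le>n. qbinom n k q * (u ^ k * v ^ (n - k) * askey_factor c d u (v * q ^ k))"
  have less: "norm (e * (v * q)) < 1" if "norm (e * v) < 1" for e
    using norm_mult_power_q_less[OF that, of 1] by (simp add: mult_ac)
  have "moment (Suc n) c d u v = v * (theta_factor u v * ?S v - theta_factor u (v * q) * ?S (v * q))"
    using Suc.prems q_nz by (simp add: moment_Suc Suc.IH less)
  also have "\<dots> = theta_factor u v * (v * ?S v) - v * theta_factor u (v * q) * ?S (v * q)"
    by (simp add: algebra_simps)
  also have "\<dots> = theta_factor u v * (v * ?S v + u * ?S (v * q))"
    unfolding theta_factor_mult_q[OF Suc.prems(1,2)] by (simp add: algebra_simps)
  also have "v * ?S v = (\<Sum>k\<le>n. qbinom n k q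
      * (u ^ k * v ^ (Suc n - k) * askey_factor c d u (v * q ^ k)))"
    unfolding sum_distrib_left by (intro sum.cong refl) (simp add: Suc_diff_le mult_ac)
  also have "u * ?S (v * q) = (\<Sum>k\<le>n. qbinom n k q * (q ^ (n - k)
      * (u ^ Suc k * v ^ (Suc n - Suc k) * askey_factor c d u (v * q ^ Suc k))))"
    unfolding sum_distrib_left by (intro sum.cong refl) (simp add: power_mult_distrib mult_ac)
  also note qbinom_sum_Suc[symmetric]
  finally show ?case .
qed

text \<open>Only the products in \<open>c * v\<close>, \<open>d * v\<close> and
  \<open>c * d * u * v\<close> contain \<open>v\<close>; each loses its first \<open>k\<close>
  factors.\<close>

lemma askey_factor_mult_power_q:
  assumes "norm (c * u) < 1" and "norm (c * v) < 1" and "norm (d * u) < 1" and "norm (d * v) < 1"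
  shows "askey_factor c d u (v * q ^ k)
     = askey_factor c d u v * (qpoch (d * v) k q * qpoch (c * v) k q / qpoch (d * c * u * v) k q)"
proof -
  have "norm (c * u) * norm (d * v) < 1 * 1"
    using assms by (intro mult_strict_mono) auto
  then have "norm (d * c * u * v) < 1" by (simp add: norm_mult mult_ac)
  then show ?thesis
    using qpoch_inf_split[of "d * c * u * v" k] qpoch_inf_split[of "c * v" k]
      qpoch_inf_split[of "d * v" k] qpoch_nz assms
    by (simp add: askey_factor_def qpoch_inf_nz mult_ac)
qed

lemma moment_eq:
  assumes "u \<noteq> 0" and "v \<noteq> 0"
    and "norm (c * u) < 1" and "norm (c * v) < 1" and "norm (d * u) < 1" and "norm (d * v) < 1"
  shows "moment n c d u v = theta_factor u v * askey_factor c d u v * W_poly q n d c u v"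
  unfolding moment_eq_sum[OF assms] W_poly_def qpochs_pair mult.assoc[of "theta_factor u v"]
    sum_distrib_left
  using assms by (intro sum.cong refl) (simp add: askey_factor_mult_power_q mult_ac)

subsection \<open>Generating function of the little \<open>q\<close>-Jacobi polynomials\<close>

lemma prod_q_power: "(\<Prod>i<k. q ^ i) = q ^ (k * (k - 1) div 2)"
proof (induction k)
  case (Suc k)
  then show ?case by (simp only: triangle_Suc power_add prod.lessThan_Suc)
qed simp

text \<open>Homogeneous in \<open>a\<close> and \<open>b\<close>; the two halves of the q-Pascal sum
  contribute \<open>- a\<close> and \<open>b * q ^ n\<close>, the two parts of the new
  factor.\<close>

lemma qbinomial_theorem:
  "(\<Prod>i<n. b * q ^ i - a)
     = (\<Sum>k\<le>n. qbinom n k q * (q ^ (k * (k - 1) div 2) * b ^ k * (- a) ^ (n - k)))"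
proof (induction n)
  case (Suc n)
  let ?f = "\<lambda>n k. q ^ (k * (k - 1) div 2) * b ^ k * (- a) ^ (n - k)"
  have 1: "qbinom n k q * ?f (Suc n) k = (- a) * (qbinom n k q * ?f n k)" if "k \<le> n" for k
    using that by (simp add: Suc_diff_le)
  have 2: "qbinom n k q * (q ^ (n - k) * ?f (Suc n) (Suc k))
      = b * q ^ n * (qbinom n k q * ?f n k)" if "k \<le> n" for k
  proof -
    have "q ^ n = q ^ (n - k) * q ^ k" using that by (simp add: power_add[symmetric])
    then show ?thesis unfolding triangle_Suc power_add diff_Suc_Suc power_Suc by (simp only: mult_ac)
  qed
  have "(\<Sum>k\<le>Suc n. qbinom (Suc n) k q * ?f (Suc n) k)
      = (- a) * (\<Sum>k\<le>n. qbinom n k q * ?f n k) + b * q ^ n * (\<Sum>k\<le>n. qbinom n k q * ?f n k)"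
    unfolding qbinom_sum_Suc sum_distrib_left using 1 2
    by (intro arg_cong2[of _ _ _ _ "(+)"] sum.cong refl) auto
  then show ?case using Suc.IH by (simp add: algebra_simps)
qed simp

text \<open>The q-Chu-Vandermonde sum in polynomial form, free of negative powers of
  \<open>q\<close>. The second half of the q-Pascal sum replaces \<open>x\<close>, \<open>y\<close>
  by \<open>x * q\<close>, \<open>y / q\<close> and preserves their product, hence the induction
  over arbitrary \<open>x\<close> and \<open>y\<close>.\<close>

lemma q_vandermonde:
  "(\<Sum>k\<le>n. qbinom n k q * (x ^ k * q ^ (k * (k - 1) div 2) * (\<Prod>i<k. q ^ i - y)
       * qpoch (x * q ^ k) (n - k) q)) = qpoch (x * y) n q"
proof (induction n arbitrary: x y)
  case (Suc n)
  let ?f = "\<lambda>x y n k. x ^ k * q ^ (k * (k - 1) div 2) * (\<Prod>i<k. q ^ i - y)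
    * qpoch (x * q ^ k) (n - k) q"
  have 1: "qbinom n k q * ?f x y (Suc n) k = (1 - x * q ^ n) * (qbinom n k q * ?f x y n k)"
    if "k \<le> n" for k
  proof -
    have "x * q ^ k * q ^ (n - k) = x * q ^ n"
      using that by (simp add: power_add[symmetric] mult.assoc)
    then show ?thesis using that by (simp add: Suc_diff_le qpoch_Suc)
  qed
  have 2: "qbinom n k q * (q ^ (n - k) * ?f x y (Suc n) (Suc k))
      = x * q ^ n * (1 - y) * (qbinom n k q * ?f (x * q) (y / q) n k)" if "k \<le> n" for k
  proof -
    have *: "q ^ n = q ^ (n - k) * q ^ k" using that by (simp add: power_add[symmetric])
    have "(\<Prod>i<k. q ^ Suc i - y) = (\<Prod>i<k. q * (q ^ i - y / q))"
      using q_nz by (intro prod.cong) (simp_all add: field_simps)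
    then have **: "(\<Prod>i<Suc k. q ^ i - y) = (1 - y) * (q ^ k * (\<Prod>i<k. q ^ i - y / q))"
      unfolding prod.lessThan_Suc_shift by (simp add: prod.distrib)
    show ?thesis
      unfolding ** triangle_Suc power_add diff_Suc_Suc power_Suc power_mult_distrib *
      by (simp only: mult_ac)
  qed
  have "(\<Sum>k\<le>Suc n. qbinom (Suc n) k q * ?f x y (Suc n) k)
      = (1 - x * q ^ n) * (\<Sum>k\<le>n. qbinom n k q * ?f x y n k)
        + x * q ^ n * (1 - y) * (\<Sum>k\<le>n. qbinom n k q * ?f (x * q) (y / q) n k)"
    unfolding qbinom_sum_Suc sum_distrib_left using 1 2
    by (intro arg_cong2[of _ _ _ _ "(+)"] sum.cong refl) auto
  also have "\<dots> = (1 - x * q ^ n) * qpoch (x * y) n q + x * q ^ n * (1 - y) * qpoch (x * y) n q"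
    unfolding Suc.IH using q_nz by simp
  also have "\<dots> = qpoch (x * y) (Suc n) q"
    by (simp add: qpoch_Suc algebra_simps)
  finally show ?case .
qed simp

text \<open>Read in reverse order, the last \<open>k\<close> factors of
  \<open>qpoch (b * q) n q\<close> become, after distributing the triangular power, the product in
  \<open>q_vandermonde\<close> with \<open>y = b * q ^ n\<close>.\<close>

lemma q_triangle_qpoch:
  assumes "k \<le> n"
  shows "q ^ (k * (k - 1) div 2) * qpoch (b * q * q ^ (n - k)) k q = (\<Prod>i<k. q ^ i - b * q ^ n)"
proof -
  have "qpoch (b * q * q ^ (n - k)) k q = (\<Prod>i<k. 1 - b * q * q ^ (n - k) * q ^ (k - Suc i))"
    unfolding qpoch_def by (rule prod.nat_diff_reindex[symmetric])
  also have "\<dots> = (\<Prod>i<k. 1 - b * q ^ (n - i))"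
  proof (intro prod.cong refl)
    fix i assume "i \<in> {..<k}"
    then have "n - i = Suc (n - k + (k - Suc i))" using assms by auto
    then have "q ^ (n - i) = q * q ^ (n - k) * q ^ (k - Suc i)"
      by (simp only: power_Suc power_add mult_ac)
    then show "1 - b * q * q ^ (n - k) * q ^ (k - Suc i) = 1 - b * q ^ (n - i)"
      by (simp only: mult_ac)
  qed
  finally have rev: "qpoch (b * q * q ^ (n - k)) k q = (\<Prod>i<k. 1 - b * q ^ (n - i))" .
  have "q ^ (k * (k - 1) div 2) * qpoch (b * q * q ^ (n - k)) k q
      = (\<Prod>i<k. q ^ i * (1 - b * q ^ (n - i)))"
    unfolding rev prod.distrib prod_q_power ..
  also have "\<dots> = (\<Prod>i<k. q ^ i - b * q ^ n)"
  proof (intro prod.cong refl)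
    fix i assume "i \<in> {..<k}"
    then have "q ^ n = q ^ i * q ^ (n - i)" using assms by (simp add: power_add[symmetric])
    then show "q ^ i * (1 - b * q ^ (n - i)) = q ^ i - b * q ^ n"
      by (simp add: algebra_simps)
  qed
  finally show ?thesis .
qed

text \<open>Over a common denominator this is \<open>q_vandermonde\<close> with
  \<open>x = \<alpha> * q\<close> and \<open>y = \<beta> * q ^ n\<close>. Of the two triangular
  powers in \<open>q ^ (k * (k - 1))\<close>, one is explicit there and the other enters the
  product.\<close>

lemma sum_qpoch_quotients:
  assumes "norm (\<alpha> * q) < 1" and "norm (\<beta> * q) < 1" and "m \<le> n"
  shows "(\<Sum>k\<le>m. q ^ (k * (k - 1)) * (\<alpha> * q) ^ k
       / (qpoch (\<alpha> * q) k q * qpoch q k q * qpoch q (m - k) q * qpoch (\<beta> * q) (n - k) q))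
     = qpoch (\<alpha> * \<beta> * q ^ (n + 1)) m q
       / (qpoch (\<alpha> * q) m q * qpoch (\<beta> * q) n q * qpoch q m q)"
    (is "sum ?t _ = _ / ?d")
proof -
  have "?t k = qbinom m k q * ((\<alpha> * q) ^ k * q ^ (k * (k - 1) div 2)
      * (\<Prod>i<k. q ^ i - \<beta> * q ^ n) * qpoch (\<alpha> * q * q ^ k) (m - k) q) / ?d" if "k \<le> m" for k
  proof -
    have "k \<le> n" using that assms(3) by simp
    have \<alpha>: "qpoch (\<alpha> * q) m q = qpoch (\<alpha> * q) k q * qpoch (\<alpha> * q * q ^ k) (m - k) q"
      using qpoch_add[of "\<alpha> * q" k "m - k" q] that by simp
    have \<beta>: "qpoch (\<beta> * q) n q = qpoch (\<beta> * q) (n - k) q * qpoch (\<beta> * q * q ^ (n - k)) k q"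
      using qpoch_add[of "\<beta> * q" "n - k" k q] \<open>k \<le> n\<close> by simp
    have "q ^ (k * (k - 1)) = q ^ (k * (k - 1) div 2) * q ^ (k * (k - 1) div 2)"
      by (subst double_triangle) (simp add: mult_2 power_add)
    moreover have "qpoch (\<alpha> * q * q ^ k) (m - k) q / qpoch (\<alpha> * q) m q = 1 / qpoch (\<alpha> * q) k q"
      using qpoch_nz[OF assms(1), of m] by (simp add: \<alpha>)
    moreover have "qpoch (\<beta> * q * q ^ (n - k)) k q / qpoch (\<beta> * q) n q = 1 / qpoch (\<beta> * q) (n - k) q"
      using qpoch_nz[OF assms(2), of n] by (simp add: \<beta>)
    moreover have "qbinom m k q / qpoch q m q = 1 / (qpoch q k q * qpoch q (m - k) q)"
      by (simp add: qbinom_def)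
    moreover have "qbinom m k q * ((\<alpha> * q) ^ k * q ^ (k * (k - 1) div 2)
        * (\<Prod>i<k. q ^ i - \<beta> * q ^ n) * qpoch (\<alpha> * q * q ^ k) (m - k) q) / ?d
      = (qpoch (\<alpha> * q * q ^ k) (m - k) q / qpoch (\<alpha> * q) m q)
        * (qpoch (\<beta> * q * q ^ (n - k)) k q / qpoch (\<beta> * q) n q) * (qbinom m k q / qpoch q m q)
        * ((\<alpha> * q) ^ k * (q ^ (k * (k - 1) div 2) * q ^ (k * (k - 1) div 2)))"
      unfolding q_triangle_qpoch[OF \<open>k \<le> n\<close>, symmetric]
      by (simp only: divide_inverse inverse_mult_distrib mult_ac)
    ultimately show ?thesis
      by (simp only: divide_inverse inverse_mult_distrib mult_ac mult_1_left)
  qed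
  then have "sum ?t {..m} = (\<Sum>k\<le>m. qbinom m k q * ((\<alpha> * q) ^ k * q ^ (k * (k - 1) div 2)
      * (\<Prod>i<k. q ^ i - \<beta> * q ^ n) * qpoch (\<alpha> * q * q ^ k) (m - k) q) / ?d)"
    by (intro sum.cong) auto
  also have "\<dots> = qpoch (\<alpha> * q * (\<beta> * q ^ n)) m q / ?d"
    unfolding sum_divide_distrib[symmetric] q_vandermonde ..
  finally show ?thesis by (simp add: mult_ac)
qed

definition phi01_coeff :: "complex \<Rightarrow> complex \<Rightarrow> nat \<Rightarrow> complex" where
  "phi01_coeff \<alpha> a k
     = q ^ (k * (k - 1)) * (- \<alpha> * q * a) ^ k / (qpoch (\<alpha> * q) k q * qpoch q k q)"

definition phi21_coeff :: "complex \<Rightarrow> complex \<Rightarrow> complex \<Rightarrow> nat \<Rightarrow> complex" where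
  "phi21_coeff \<beta> a b k
     = qpoch (b / a) k q / (qpoch (\<beta> * q) k q * qpoch q k q) * (- a) ^ k"

lemma qpoch_divide_mult_power:
  assumes "a \<noteq> 0"
  shows "qpoch (b / a) n q * (- a) ^ n = (\<Prod>i<n. b * q ^ i - a)"
proof -
  have "qpoch (b / a) n q * (- a) ^ n = (\<Prod>i<n. (1 - b / a * q ^ i) * (- a))"
    by (simp only: qpoch_def prod.distrib prod_constant card_lessThan)
  also have "\<dots> = (\<Prod>i<n. b * q ^ i - a)"
    using assms by (intro prod.cong refl) (simp add: field_simps)
  finally show ?thesis .
qed

text \<open>The q-binomial theorem makes each second factor a form in \<open>a\<close> and
  \<open>b\<close>; collecting the terms with \<open>(- a) ^ m * b ^ (n - m)\<close> leaves the
  inner sum of \<open>sum_qpoch_quotients\<close>.\<close>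

lemma cauchy_coeff_eq_little_q_jacobi:
  assumes "a \<noteq> 0" and "norm (\<alpha> * q) < 1" and "norm (\<beta> * q) < 1"
  shows "(\<Sum>k\<le>n. phi01_coeff \<alpha> a k * phi21_coeff \<beta> a b (n - k))
     = q ^ (n * (n - 1) div 2) / (qpoch (\<beta> * q) n q * qpoch q n q) * little_q_jacobi q \<alpha> \<beta> n a b"
proof -
  let ?g = "\<lambda>k j. phi01_coeff \<alpha> a k / (qpoch (\<beta> * q) (n - k) q * qpoch q (n - k) q)
    * (qbinom (n - k) j q * (q ^ (j * (j - 1) div 2) * b ^ j * (- a) ^ (n - k - j)))"
  have "phi21_coeff \<beta> a b m = (\<Sum>j\<le>m. qbinom m j q
      * (q ^ (j * (j - 1) div 2) * b ^ j * (- a) ^ (m - j))) / (qpoch (\<beta> * q) m q * qpoch q m q)" for m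
    using qpoch_divide_mult_power[OF assms(1), of b m]
    by (simp add: phi21_coeff_def qbinomial_theorem)
  then have "(\<Sum>k\<le>n. phi01_coeff \<alpha> a k * phi21_coeff \<beta> a b (n - k)) = (\<Sum>k\<le>n. \<Sum>j\<le>n - k. ?g k j)"
    by (simp add: sum_distrib_left sum_divide_distrib)
  also have "\<dots> = (\<Sum>m\<le>n. \<Sum>k\<le>m. ?g k (n - m))"
    by (rule sum_triangle_antidiagonal)
  also have "\<dots> = (\<Sum>m\<le>n. q ^ (n * (n - 1) div 2) / (qpoch (\<beta> * q) n q * qpoch q n q)
      * (q powi (int m * (int m + 1 - 2 * int n) div 2) * qbinom n m q
        * (qpoch (\<alpha> * \<beta> * q ^ (n + 1)) m q / qpoch (\<alpha> * q) m q) * (- a) ^ m * b ^ (n - m)))"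
  proof (intro sum.cong refl)
    fix m assume "m \<in> {..n}"
    then have mn: "m \<le> n" by simp
    have pw: "q ^ ((n - m) * (n - m - 1) div 2)
        = q ^ (n * (n - 1) div 2) * q powi (int m * (int m + 1 - 2 * int n) div 2)"
      using power_int_add[OF disjI1[OF q_nz], of "int (n * (n - 1) div 2)"
          "int m * (int m + 1 - 2 * int n) div 2"]
      by (simp only: triangle_exponent[OF mn] power_int_of_nat)
    let ?c = "q ^ ((n - m) * (n - m - 1) div 2) * b ^ (n - m) * (- a) ^ m / qpoch q (n - m) q"
    have "(\<Sum>k\<le>m. ?g k (n - m)) = (\<Sum>k\<le>m. ?c * (q ^ (k * (k - 1)) * (\<alpha> * q) ^ k
       / (qpoch (\<alpha> * q) k q * qpoch q k q * qpoch q (m - k) q * qpoch (\<beta> * q) (n - k) q)))"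
    proof (intro sum.cong refl)
      fix k assume "k \<in> {..m}"
      then have nkm: "n - k - (n - m) = m - k" and am: "(- a) ^ m = (- a) ^ k * (- a) ^ (m - k)"
        using mn by (auto simp: power_add[symmetric])
      have pow: "(- \<alpha> * q * a) ^ k = (\<alpha> * q) ^ k * (- a) ^ k"
        by (simp add: power_mult_distrib[symmetric] mult_ac)
      \<comment> \<open>The Gaussian binomial cancels the factor \<open>qpoch q (n - k) q\<close> in
        the denominator of \<open>phi21_coeff\<close>.\<close>
      have "qbinom (n - k) (n - m) q / qpoch q (n - k) q
          = 1 / (qpoch q (n - m) q * qpoch q (m - k) q)"
        unfolding qbinom_def nkm by simp
      moreover have "?g k (n - m) = (qbinom (n - k) (n - m) q / qpoch q (n - k) q)
          * (phi01_coeff \<alpha> a k / qpoch (\<beta> * q) (n - k) q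
            * (q ^ ((n - m) * (n - m - 1) div 2) * b ^ (n - m) * (- a) ^ (m - k)))"
        unfolding nkm by (simp only: divide_inverse inverse_mult_distrib mult_ac)
      ultimately show "?g k (n - m) = ?c * (q ^ (k * (k - 1)) * (\<alpha> * q) ^ k
         / (qpoch (\<alpha> * q) k q * qpoch q k q * qpoch q (m - k) q * qpoch (\<beta> * q) (n - k) q))"
        unfolding phi01_coeff_def pow am
        by (simp only: divide_inverse inverse_mult_distrib mult_ac mult_1_left mult_1_right)
    qed
    also have "\<dots> = ?c * (qpoch (\<alpha> * \<beta> * q ^ (n + 1)) m q
       / (qpoch (\<alpha> * q) m q * qpoch (\<beta> * q) n q * qpoch q m q))"
      unfolding sum_distrib_left[symmetric] sum_qpoch_quotients[OF assms(2,3) mn] ..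
    finally show "(\<Sum>k\<le>m. ?g k (n - m)) = q ^ (n * (n - 1) div 2) / (qpoch (\<beta> * q) n q * qpoch q n q)
      * (q powi (int m * (int m + 1 - 2 * int n) div 2) * qbinom n m q
        * (qpoch (\<alpha> * \<beta> * q ^ (n + 1)) m q / qpoch (\<alpha> * q) m q) * (- a) ^ m * b ^ (n - m))"
      unfolding pw by (simp add: qbinom_def divide_inverse mult_ac)
  qed
  finally show ?thesis
    by (simp only: little_q_jacobi_def sum_distrib_left)
qed

section \<open>Absolute convergence and termwise integration of the generating function\<close>

lemma convergent_inverse_qpoch:
  assumes "norm a < 1"
  shows "convergent (\<lambda>k. inverse (qpoch a k q))"
  using tendsto_inverse[OF qpoch_LIMSEQ qpoch_inf_nz[OF assms]] by (auto simp: convergent_def)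

lemma summable_norm_bounded_mult_power:
  fixes z :: complex
  assumes "Bseq s" and "norm z < 1"
  shows "summable (\<lambda>k. norm (s k * z ^ k))"
proof -
  obtain M where M: "\<And>k. norm (s k) \<le> M" using assms(1) by (auto elim!: BseqE)
  have "summable (\<lambda>k. M * norm z ^ k)"
    using assms(2) by (intro summable_mult summable_geometric) simp
  then show ?thesis
    by (rule summable_comparison_test') (simp add: norm_mult norm_power mult_right_mono M)
qed

text \<open>Bounding \<open>q ^ (k * (k - 1))\<close> by 1 suffices, since the two hypotheses
  multiply to a geometric ratio below 1.\<close>

lemma summable_norm_phi01:
  assumes "norm (\<alpha> * q) < 1" and "norm (a * x) < 1"
  shows "summable (\<lambda>k. norm (phi01_coeff \<alpha> a k * x ^ k))"
proof -
  have "Bseq (\<lambda>k. q ^ (k * (k - 1)))"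
    using norm_q by (intro BseqI'[of _ 1]) (simp add: norm_power power_le_one)
  moreover have "Bseq (\<lambda>k. inverse (qpoch (\<alpha> * q) k q) * inverse (qpoch q k q))"
    using assms(1) norm_q
    by (intro convergent_imp_Bseq convergent_mult convergent_inverse_qpoch)
  ultimately have "Bseq (\<lambda>k. q ^ (k * (k - 1)) * (inverse (qpoch (\<alpha> * q) k q) * inverse (qpoch q k q)))"
    by (rule Bseq_mult)
  moreover have "norm (\<alpha> * q) * norm (a * x) < 1 * 1"
    using assms by (intro mult_strict_mono) auto
  then have "norm (- \<alpha> * q * a * x) < 1" by (simp add: norm_mult mult_ac)
  ultimately have "summable (\<lambda>k. norm (q ^ (k * (k - 1))
      * (inverse (qpoch (\<alpha> * q) k q) * inverse (qpoch q k q)) * (- \<alpha> * q * a * x) ^ k))"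
    by (rule summable_norm_bounded_mult_power)
  also have "(\<lambda>k. norm (q ^ (k * (k - 1))
      * (inverse (qpoch (\<alpha> * q) k q) * inverse (qpoch q k q)) * (- \<alpha> * q * a * x) ^ k))
      = (\<lambda>k. norm (phi01_coeff \<alpha> a k * x ^ k))"
    unfolding phi01_coeff_def power_mult_distrib[of "- \<alpha> * q * a" x] by (simp add: field_simps)
  finally show ?thesis .
qed

lemma summable_norm_phi21:
  assumes "norm (\<beta> * q) < 1" and "norm (a * x) < 1"
  shows "summable (\<lambda>k. norm (phi21_coeff \<beta> a b k * x ^ k))"
proof -
  have "convergent (\<lambda>k. qpoch (b / a) k q)"
    using qpoch_LIMSEQ by (auto simp: convergent_def)
  then have "Bseq (\<lambda>k. qpoch (b / a) k q * (inverse (qpoch (\<beta> * q) k q) * inverse (qpoch q k q)))"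
    using assms(1) norm_q
    by (intro convergent_imp_Bseq convergent_mult convergent_inverse_qpoch)
  moreover have "norm (- a * x) < 1" using assms by simp
  ultimately have "summable (\<lambda>k. norm (qpoch (b / a) k q
      * (inverse (qpoch (\<beta> * q) k q) * inverse (qpoch q k q)) * (- a * x) ^ k))"
    by (rule summable_norm_bounded_mult_power)
  also have "(\<lambda>k. norm (qpoch (b / a) k q
      * (inverse (qpoch (\<beta> * q) k q) * inverse (qpoch q k q)) * (- a * x) ^ k))
      = (\<lambda>k. norm (phi21_coeff \<beta> a b k * x ^ k))"
    unfolding phi21_coeff_def power_mult_distrib by (simp add: field_simps)
  finally show ?thesis .
qed

definition genfun_coeff :: "complex \<Rightarrow> complex \<Rightarrow> complex \<Rightarrow> complex \<Rightarrow> nat \<Rightarrow> complex" where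
  "genfun_coeff \<alpha> \<beta> a b n = (\<Sum>k\<le>n. phi01_coeff \<alpha> a k * phi21_coeff \<beta> a b (n - k))"

lemma genfun_coeff_mult_power:
  "genfun_coeff \<alpha> \<beta> a b n * x ^ n
     = (\<Sum>k\<le>n. (phi01_coeff \<alpha> a k * x ^ k) * (phi21_coeff \<beta> a b (n - k) * x ^ (n - k)))"
  unfolding genfun_coeff_def sum_distrib_right
proof (intro sum.cong refl)
  fix k assume "k \<in> {..n}"
  then have "x ^ n = x ^ k * x ^ (n - k)" by (simp add: power_add[symmetric])
  then show "phi01_coeff \<alpha> a k * phi21_coeff \<beta> a b (n - k) * x ^ n
      = phi01_coeff \<alpha> a k * x ^ k * (phi21_coeff \<beta> a b (n - k) * x ^ (n - k))"
    by (simp only: mult_ac)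
qed

context
  fixes \<alpha> \<beta> a b x :: complex
  assumes \<alpha>: "norm (\<alpha> * q) < 1" and \<beta>: "norm (\<beta> * q) < 1" and ax: "norm (a * x) < 1"
begin

lemma genfun_sums:
  "(\<lambda>n. genfun_coeff \<alpha> \<beta> a b n * x ^ n) sums
     (phi01 (\<alpha> * q) q (- \<alpha> * q * a * x) * phi21_zero (b / a) (\<beta> * q) q (- a * x))"
proof -
  have "phi01 (\<alpha> * q) q (- \<alpha> * q * a * x) = (\<Sum>k. phi01_coeff \<alpha> a k * x ^ k)"
    unfolding phi01_def phi01_coeff_def power_mult_distrib[of "- \<alpha> * q * a" x]
    by (simp add: mult.assoc)
  moreover have "phi21_zero (b / a) (\<beta> * q) q (- a * x) = (\<Sum>k. phi21_coeff \<beta> a b k * x ^ k)"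
    unfolding phi21_zero_def phi21_coeff_def power_mult_distrib by (simp add: mult_ac)
  ultimately show ?thesis
    unfolding genfun_coeff_mult_power
    using Cauchy_product_sums[OF summable_norm_phi01[OF \<alpha> ax] summable_norm_phi21[OF \<beta> ax]] by simp
qed

lemma summable_norm_genfun: "summable (\<lambda>n. norm (genfun_coeff \<alpha> \<beta> a b n * x ^ n))"
proof (rule summable_comparison_test')
  show "summable (\<lambda>n. \<Sum>k\<le>n. norm (phi01_coeff \<alpha> a k * x ^ k)
      * norm (phi21_coeff \<beta> a b (n - k) * x ^ (n - k)))"
    using summable_norm_phi01[OF \<alpha> ax] summable_norm_phi21[OF \<beta> ax]
    by (intro summable_Cauchy_product) simp_all
  show "norm (norm (genfun_coeff \<alpha> \<beta> a b n * x ^ n))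
      \<le> (\<Sum>k\<le>n. norm (phi01_coeff \<alpha> a k * x ^ k) * norm (phi21_coeff \<beta> a b (n - k) * x ^ (n - k)))"
    for n
    unfolding genfun_coeff_mult_power norm_mult[symmetric] real_norm_def abs_norm_cancel
    by (rule norm_sum)
qed

end

text \<open>The bound depends neither on the lattice point nor on the number of terms: the norms are
  largest at \<open>n = 0\<close>. This is the domination needed for integrating termwise.\<close>

lemma norm_partial_genfun_le:
  assumes "norm (\<alpha> * q) < 1" and "norm (\<beta> * q) < 1" and "norm (a * t) < 1"
  shows "norm (\<Sum>k<m. genfun_coeff \<alpha> \<beta> a b k * (t * q ^ n) ^ k)
     \<le> (\<Sum>k. norm (genfun_coeff \<alpha> \<beta> a b k * t ^ k))"
proof -
  have "norm (genfun_coeff \<alpha> \<beta> a b k * (t * q ^ n) ^ k) \<le> norm (genfun_coeff \<alpha> \<beta> a b k * t ^ k)" for k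
  proof -
    have "norm (genfun_coeff \<alpha> \<beta> a b k * (t * q ^ n) ^ k)
        = norm (genfun_coeff \<alpha> \<beta> a b k * t ^ k) * (norm q ^ n) ^ k"
      by (simp add: norm_mult norm_power power_mult_distrib)
    also have "\<dots> \<le> norm (genfun_coeff \<alpha> \<beta> a b k * t ^ k) * 1"
      using norm_q by (intro mult_left_mono power_le_one) auto
    finally show ?thesis by simp
  qed
  then have "norm (\<Sum>k<m. genfun_coeff \<alpha> \<beta> a b k * (t * q ^ n) ^ k)
      \<le> (\<Sum>k<m. norm (genfun_coeff \<alpha> \<beta> a b k * t ^ k))"
    by (intro sum_norm_le)
  also have "\<dots> \<le> (\<Sum>k. norm (genfun_coeff \<alpha> \<beta> a b k * t ^ k))"
    by (intro sum_le_suminf summable_norm_genfun assms) auto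
  finally show ?thesis .
qed

text \<open>The partial sums times the weight converge pointwise on both lattices and are uniformly
  bounded there, so dominated convergence also gives the convergence of the series of
  moments.\<close>

lemma jackson_integral_genfun_sums:
  assumes "norm (\<alpha> * q) < 1" and "norm (\<beta> * q) < 1" and "norm (a * u) < 1" and "norm (a * v) < 1"
  shows "(\<lambda>k. genfun_coeff \<alpha> \<beta> a b k * moment k c d u v) sums
     jackson_integral q u v (\<lambda>x. weight c d u v x
       * phi01 (\<alpha> * q) q (- \<alpha> * q * a * x) * phi21_zero (b / a) (\<beta> * q) q (- a * x))"
proof -
  let ?C = "genfun_coeff \<alpha> \<beta> a b" and ?w = "weight c d u v"
  define G where "G x = ?w x * phi01 (\<alpha> * q) q (- \<alpha> * q * a * x)
    * phi21_zero (b / a) (\<beta> * q) q (- a * x)" for x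
  define F where "F m x = ?w x * (\<Sum>k<m. ?C k * x ^ k)" for m x
  have lim: "(\<lambda>m. F m (t * q ^ n)) \<longlonglongrightarrow> G (t * q ^ n)" if "norm (a * t) < 1" for t n
  proof -
    have "norm (a * (t * q ^ n)) < 1"
      using norm_mult_power_q_less[OF that, of n] by (simp add: mult_ac)
    then show ?thesis
      using genfun_sums[OF assms(1,2)]
      unfolding F_def G_def sums_def mult.assoc by (intro tendsto_mult_left) blast
  qed
  have bound: "\<exists>M. \<forall>m n. norm (F m (t * q ^ n)) \<le> M" if at: "norm (a * t) < 1" for t
  proof -
    obtain M where M: "\<And>n. norm (?w (t * q ^ n)) \<le> M"
      using conv_at_bounded[OF weight_conv_at] by blast
    have "norm (F m (t * q ^ n)) \<le> M * (\<Sum>k. norm (?C k * t ^ k))" for m n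
      unfolding F_def norm_mult[of "?w (t * q ^ n)"]
      using M order_trans[OF norm_ge_zero M]
      by (intro mult_mono norm_partial_genfun_le assms(1,2) at) auto
    then show ?thesis by blast
  qed
  obtain M1 where M1: "\<And>m n. norm (F m (u * q ^ n)) \<le> M1"
    using bound[OF assms(3)] by blast
  obtain M2 where M2: "\<And>m n. norm (F m (v * q ^ n)) \<le> M2"
    using bound[OF assms(4)] by blast
  have "(\<lambda>m. jackson_integral q u v (F m)) \<longlonglongrightarrow> jackson_integral q u v G"
    by (rule jackson_integral_tendsto[where M = "max M1 M2"])
       (use lim assms(3,4) M1 M2 in \<open>auto intro: max.coboundedI1 max.coboundedI2\<close>)
  moreover have "jackson_integral q u v (F m) = (\<Sum>k<m. ?C k * moment k c d u v)" for m
  proof -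
    have "F m = (\<lambda>x. \<Sum>k<m. ?C k * (x ^ k * ?w x))"
      by (auto simp: F_def sum_distrib_left mult_ac)
    then have "jackson_integral q u v (F m)
        = (\<Sum>k<m. jackson_integral q u v (\<lambda>x. ?C k * (x ^ k * ?w x)))"
      using conv_at_mult[OF conv_at_const moment_integrand_conv_at]
      by (simp add: jackson_integral_sum)
    also have "\<dots> = (\<Sum>k<m. ?C k * moment k c d u v)"
      unfolding moment_def
      by (intro sum.cong refl jackson_integral_cmult moment_integrand_conv_at)
    finally show ?thesis .
  qed
  ultimately show ?thesis unfolding sums_def G_def[abs_def] by simp
qed

end

section \<open>Evaluation of the integral\<close>

theorem theorem5p7:
  fixes q a b c d u v \<alpha> \<beta> :: complex
  assumes "0 < norm q" and "norm q < 1"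
    and "a \<noteq> 0" and "u \<noteq> 0" and "v \<noteq> 0"
    and "Max {norm (a * u), norm (a * v), norm (c * u), norm (c * v),
              norm (d * u), norm (d * v), norm (\<alpha> * q), norm (\<beta> * q)} < 1"
  shows "jackson_integral q u v
           (\<lambda>x. qpochs_inf [q * x / u, q * x / v] q / qpochs_inf [c * x, d * x] q
                * phi01 (\<alpha> * q) q (- \<alpha> * q * a * x)
                * phi21_zero (b / a) (\<beta> * q) q (- a * x))
       = (1 - q) * v * qpochs_inf [q, u / v, q * v / u, d * c * u * v] q
           / qpochs_inf [d * u, d * v, c * u, c * v] q
         * (\<Sum>n. q ^ (n * (n - 1) div 2) * W_poly q n d c u v / (qpoch (\<beta> * q) n q * qpoch q n q)
                * little_q_jacobi q \<alpha> \<beta> n a b)"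
proof -
  interpret q_base q
    using assms(1,2) by unfold_locales auto
  have bounds: "norm (a * u) < 1" "norm (a * v) < 1" "norm (c * u) < 1" "norm (c * v) < 1"
    "norm (d * u) < 1" "norm (d * v) < 1" "norm (\<alpha> * q) < 1" "norm (\<beta> * q) < 1"
    using Max_less_iff[THEN iffD1, OF _ _ assms(6)] by simp_all
  let ?K = "theta_factor u v * askey_factor c d u v"
  let ?f = "\<lambda>n. q ^ (n * (n - 1) div 2) * W_poly q n d c u v
    / (qpoch (\<beta> * q) n q * qpoch q n q) * little_q_jacobi q \<alpha> \<beta> n a b"
  let ?I = "jackson_integral q u v (\<lambda>x. qpochs_inf [q * x / u, q * x / v] q
    / qpochs_inf [c * x, d * x] q * phi01 (\<alpha> * q) q (- \<alpha> * q * a * x)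
    * phi21_zero (b / a) (\<beta> * q) q (- a * x))"
  have "genfun_coeff \<alpha> \<beta> a b n * moment n c d u v = ?K * ?f n" for n
    using moment_eq[OF assms(4,5) bounds(3-6), where n = n]
      cauchy_coeff_eq_little_q_jacobi[OF assms(3) bounds(7,8), where n = n and b = b]
    by (simp add: genfun_coeff_def)
  then have "(\<lambda>n. ?K * ?f n) sums ?I"
    using jackson_integral_genfun_sums[OF bounds(7,8,1,2), where b = b and c = c and d = d]
    by (simp add: weight_def qpochs_inf_pair)
  \<comment> \<open>\<open>?K\<close> vanishes when \<open>u / v\<close> is an integral power of
    \<open>q\<close>, so it is moved out of the series without dividing by it.\<close>
  then have "?I = ?K * (\<Sum>n. ?f n)"
    using suminf_cmult_unconditional[of ?K ?f] by (simp add: sums_iff)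
  also have "?K = (1 - q) * v * qpochs_inf [q, u / v, q * v / u, d * c * u * v] q
      / qpochs_inf [d * u, d * v, c * u, c * v] q"
    by (simp add: theta_factor_def askey_factor_def qpochs_inf_def mult_ac)
  finally show ?thesis .
qed

end
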